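(* The iterate sequence $(x(n),\gamma(n))_{n\ge0}$ generated by the stochastic saddle point mirror descent (SSPMD) algorithm converges to the set of saddle points $\mathcal S$ almost surely, i.e. almost surely $d\big((x(n),\gamma(n)),\mathcal S\big)\to0$ as $n\to\infty$.
   Context: Setting. $\mathcal X\subseteq\mathbb R^n$, $\mathcal Y\subseteq\mathbb R^m$ are nonempty, convex and compact. $L:\mathbb R^n\times\mathbb R^m\to[-\infty,+\infty]$ is convex in $x\in\mathbb R^n$ and concave in $\gamma\in\mathbb R^m$. For $(x,\gamma)\in\mathcal X\times\mathcal Y$, $\partial_xL(x,\gamma)=\{g\in\mathbb R^n: L(y,\gamma)\ge L(x,\gamma)+\langle g,y-x\rangle\ \forall y\in\mathbb R^n\}$ and $\partial_\gamma^+L(x,\gamma)=\{g\in\mathbb R^m: L(x,\delta)\le L(x,\gamma)+\langle g,\delta-\gamma\rangle\ \forall \delta\in\mathbb R^m\}$. A saddle point is $(x^*,\gamma^* )\in\mathcal X\times\mathcal Y$ with $L(x^*,\gamma)\le L(x^*,\gamma^* )\le L(x,\gamma^* )$ for all $x\in\mathcal X,\gamma\in\mathcal Y$; $\mathcal S$ is the set of saddle points. $d(z,\mathcal A)=\inf_{a\in\mathcal A}\|a-z\|$. Standing assumptions. (A1) $\mathcal S$ is nonempty and compact, and for every $(x,\gamma)\in(\mathcal X\times\mathcal Y)\setminus\mathcal S$ there is $(x^*,\gamma^* )\in\mathcal S$ with $L(x^*,\gamma)<L(x^*,\gamma^* )$ or $L(x^*,\gamma^* )<L(x,\gamma^* )$.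 (A2) For each $x\in\mathcal X$, $L(x,\cdot)$ is upper semicontinuous on $\mathbb R^m$; for each $\gamma\in\mathcal Y$, $L(\cdot,\gamma)$ is lower semicontinuous on $\mathbb R^n$. (A3) For each $(x,\gamma)\in\mathcal X\times\mathcal Y$, $\partial_xL(x,\gamma)\times\partial_\gamma^+L(x,\gamma)$ is nonempty, and there is $G>0$ such that all elements of $\partial_xL(x,\gamma)$ and $\partial^+_\gamma L(x,\gamma)$, for all $(x,\gamma)\in\mathcal X\times\mathcal Y$, have norm at most $G$. $R_x$ (on $\mathbb R^n$) and $R_\gamma$ (on $\mathbb R^m$) are extended-real-valued functions, twice continuously differentiable and $\sigma_R$-strongly convex ($\sigma_R>0$) on open sets containing $\mathcal X$ and $\mathcal Y$ respectively, and $\rho_R$-smooth (their gradients are $\rho_R$-Lipschitz). SSPMD algorithm. Let $\bar R_x=R_x+\mathcal I_{\mathcal X}$, $\bar R_\gamma=R_\gamma+\mathcal I_{\mathcal Y}$ ($\mathcal I$ = indicator function), with conjugates satisfying $\nabla\bar R_x^*(y)=\operatorname{argmax}_{z\in\mathcal X}\{\langle z,y\rangle-R_x(z)\}$, $\nabla\bar R_\gamma^*(\delta)=\operatorname{argmax}_{z\in\mathcal Y}\{\langle z,\delta\rangle-R_\gamma(z)\}$. Starting from $(x(0),\gamma(0))\in\mathcal X\times\mathcal Y$, with step sizes $\alpha(n)>0$ and random vectors (stochastic sub/supergradients) $G_x(n)\in\mathbb R^n$, $G_\gamma(n)\in\mathbb R^m$ on a probability space, $$x(n+1)=\nabla\bar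 R_x^*\big(\nabla R_x(x(n))-\alpha(n)G_x(n)\big),\qquad \gamma(n+1)=\nabla\bar R_\gamma^*\big(\nabla R_\gamma(\gamma(n))+\alpha(n)G_\gamma(n)\big).$$ Let $\mathcal F_n=\sigma(x(i),\gamma(i):0\le i\le n)$. Assumptions for all $n$: (A4) almost surely $\mathbb E[G_x(n)|\mathcal F_n]=g_x(n)\in\partial_xL(x(n),\gamma(n))$ and $\mathbb E[G_\gamma(n)|\mathcal F_n]=g_\gamma(n)\in\partial_\gamma^+L(x(n),\gamma(n))$. (A5) There is $K>0$ with $\mathbb E[\|G_x(n)\|^2|\mathcal F_n]\le K$ and $\mathbb E[\|G_\gamma(n)\|^2|\mathcal F_n]\le K$ almost surely. (A6) $\sum_n\alpha(n)=\infty$ and $\sum_n\alpha(n)^2<\infty$. *)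

theory Defs
  imports "HOL-Probability.Probability"
begin

text \<open>A function into \<open>[-\<infinity>, \<infinity>]\<close> is convex if its epigraph is a convex set;
  this avoids the undefined combination \<open>\<infinity> - \<infinity>\<close>.\<close>

definition ereal_convex :: "('a::real_vector \<Rightarrow> ereal) \<Rightarrow> bool" where
  "ereal_convex f \<longleftrightarrow> convex {(x, r::real). f x \<le> ereal r}"

definition ereal_concave :: "('a::real_vector \<Rightarrow> ereal) \<Rightarrow> bool" where
  "ereal_concave f \<longleftrightarrow> ereal_convex (\<lambda>x. - f x)"

definition lower_semicont :: "('a::topological_space \<Rightarrow> ereal) \<Rightarrow> bool" where
  "lower_semicont f \<longleftrightarrow> (\<forall>x. f x \<le> Liminf (at x) f)"

definition upper_semicont :: "('a::topological_space \<Rightarrow> ereal) \<Rightarrow> bool" where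
  "upper_semicont f \<longleftrightarrow> (\<forall>x. Limsup (at x) f \<le> f x)"

definition subdifferential :: "('a::real_inner \<Rightarrow> ereal) \<Rightarrow> 'a \<Rightarrow> 'a set" where
  "subdifferential f x = {g. \<forall>y. f y \<ge> f x + ereal (g \<bullet> (y - x))}"

definition superdifferential :: "('a::real_inner \<Rightarrow> ereal) \<Rightarrow> 'a \<Rightarrow> 'a set" where
  "superdifferential f x = {g. \<forall>y. f y \<le> f x + ereal (g \<bullet> (y - x))}"

definition saddle_points :: "'a set \<Rightarrow> 'b set \<Rightarrow> ('a \<Rightarrow> 'b \<Rightarrow> ereal) \<Rightarrow> ('a \<times> 'b) set" where
  "saddle_points X Y L =
     {(xs, ys) \<in> X \<times> Y. \<forall>x\<in>X. \<forall>y\<in>Y. L xs y \<le> L xs ys \<and> L xs ys \<le> L x ys}"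

definition grad :: "('a::real_inner \<Rightarrow> real) \<Rightarrow> 'a \<Rightarrow> 'a" where
  "grad f x = (THE g. GDERIV f x :> g)"

text \<open>Only meaningful at points near which \<open>f\<close> is finite, since \<^const>\<open>real_of_ereal\<close> sends
  both infinities to \<open>0\<close>.\<close>

definition ereal_grad :: "('a::real_inner \<Rightarrow> ereal) \<Rightarrow> 'a \<Rightarrow> 'a" where
  "ereal_grad f = grad (\<lambda>x. real_of_ereal (f x))"

text \<open>\<open>H x\<close> is the derivative of the gradient at \<open>x\<close>, i.e. the Hessian as a bounded linear map;
  continuity of \<open>H\<close> is with respect to the operator norm.\<close>

definition C2_on :: "'a::real_inner set \<Rightarrow> ('a \<Rightarrow> real) \<Rightarrow> bool" where
  "C2_on D f \<longleftrightarrow>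
     (\<exists>H :: 'a \<Rightarrow> ('a \<Rightarrow>\<^sub>L 'a).
        (\<forall>x\<in>D. GDERIV f x :> grad f x) \<and>
        (\<forall>x\<in>D. (grad f has_derivative blinfun_apply (H x)) (at x)) \<and>
        continuous_on D H)"

text \<open>The set \<open>D\<close> is not required to be convex: the inequality is imposed along all segments that
  lie in \<open>D\<close>. For convex \<open>D\<close> these are all segments between points of \<open>D\<close>.\<close>

definition strongly_convex_on :: "real \<Rightarrow> 'a::real_inner set \<Rightarrow> ('a \<Rightarrow> real) \<Rightarrow> bool" where
  "strongly_convex_on \<sigma> D f \<longleftrightarrow>
     (\<forall>x\<in>D. \<forall>y\<in>D. closed_segment x y \<subseteq> D \<longrightarrow>
        (\<forall>t\<in>{0..1}. f ((1 - t) *\<^sub>R x + t *\<^sub>R y)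
            \<le> (1 - t) * f x + t * f y - \<sigma> / 2 * t * (1 - t) * (norm (x - y))\<^sup>2))"

definition mirror_regularizer :: "real \<Rightarrow> real \<Rightarrow> 'a::real_inner set \<Rightarrow> ('a \<Rightarrow> ereal) \<Rightarrow> bool" where
  "mirror_regularizer \<sigma> \<rho> X R \<longleftrightarrow>
     (\<exists>D. open D \<and> X \<subseteq> D \<and> (\<forall>x\<in>D. \<bar>R x\<bar> \<noteq> \<infinity>) \<and>
        C2_on D (\<lambda>x. real_of_ereal (R x)) \<and>
        strongly_convex_on \<sigma> D (\<lambda>x. real_of_ereal (R x)) \<and>
        \<rho>-lipschitz_on D (ereal_grad R))"

definition convex_indicator :: "'a set \<Rightarrow> 'a \<Rightarrow> ereal" where
  "convex_indicator X z = (if z \<in> X then 0 else \<infinity>)"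

definition conjugate :: "('a::real_inner \<Rightarrow> ereal) \<Rightarrow> 'a \<Rightarrow> ereal" where
  "conjugate f y = (SUP z. ereal (z \<bullet> y) - f z)"

text \<open>The gradient of the conjugate of \<open>R\<close> restricted to \<open>X\<close>. The library has \<open>-\<infinity> + \<infinity> = \<infinity>\<close>
  in \<^typ>\<open>ereal\<close>, so the restricted function is \<open>\<infinity>\<close> off \<open>X\<close> whatever \<open>R\<close> does there.\<close>

definition mirror_map :: "'a::real_inner set \<Rightarrow> ('a \<Rightarrow> ereal) \<Rightarrow> 'a \<Rightarrow> 'a" where
  "mirror_map X R = ereal_grad (conjugate (\<lambda>z. R z + convex_indicator X z))"

definition history :: "'w measure \<Rightarrow> (nat \<Rightarrow> 'w \<Rightarrow> 'a::topological_space)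
    \<Rightarrow> (nat \<Rightarrow> 'w \<Rightarrow> 'b::topological_space) \<Rightarrow> nat \<Rightarrow> 'w measure" where
  "history M x y n = sigma (space M)
     ({x i -` A \<inter> space M | i A. i \<le> n \<and> A \<in> sets borel} \<union>
      {y i -` A \<inter> space M | i A. i \<le> n \<and> A \<in> sets borel})"

definition vec_cond_exp :: "'w measure \<Rightarrow> 'w measure \<Rightarrow> ('w \<Rightarrow> real ^ 'n) \<Rightarrow> 'w \<Rightarrow> real ^ 'n" where
  "vec_cond_exp M F V \<omega> = (\<chi> i. real_cond_exp M F (\<lambda>\<omega>'. V \<omega>' $ i) \<omega>)"

end

theory Submission
  imports Defs
begin

text \<open>
  Write \<open>z\<^sub>n = (x\<^sub>n, \<gamma>\<^sub>n)\<close> and measure the distance from a saddle point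
  \<open>s = (u\<^sub>s, v\<^sub>s)\<close> by the sum \<open>D s z\<^sub>n\<close> of the two Bregman divergences of the
  regularizers. The optimality condition of a mirror step, together with strong convexity, bounds
  the divergence after the step by the divergence before it, plus
  \<open>\<alpha>\<^sub>n\<close> times an inner product with the stochastic gradient, plus a term of order
  \<open>\<alpha>\<^sub>n\<^sup>2\<close> (\<open>mirror_step_bregman\<close>). Conditioning on the past replaces stochastic gradients by
  subgradients and supergradients, whose defining inequalities bound the inner products by the gap
  \<open>gap s z = L x v\<^sub>s - L u\<^sub>s \<gamma> \<ge> 0\<close> at \<open>z = (x, \<gamma>)\<close>. In conditional expectation,
  \<open>D s z\<^sub>n\<^sub>+\<^sub>1 \<le> D s z\<^sub>n - \<alpha>\<^sub>n gap s z\<^sub>n + O(\<alpha>\<^sub>n\<^sup>2)\<close>.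

  A bounded nonnegative process with such a drift converges almost surely and has a summable
  decrease (\<open>robbins_siegmund_bounded\<close>, proved with Doob's upcrossing strategy). Hence, almost surely
  and simultaneously for all \<open>s\<close> in a countable dense subset of the saddle points, \<open>D s z\<^sub>n\<close>
  converges and \<open>\<alpha>\<^sub>n gap s z\<^sub>n\<close> is summable.

  The rest is deterministic (\<open>quasi_fejer_convergence\<close>). Since the step sizes have infinite sum, one
  subsequence makes all these gaps tend to zero, and by compactness it can be taken to converge to
  some \<open>q\<close>. All gaps vanish at \<open>q\<close>, so the separation assumption forces \<open>q\<close> to be a
  saddle point. Finally \<open>D s z\<^sub>n\<close> has a limit for saddle points \<open>s\<close> arbitrarily close to \<open>q\<close>,
  and this limit is the value \<open>D s q\<close> seen along the subsequence, which is small; so the whole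
  sequence converges to \<open>q\<close>. Thus the iterates even converge to a single (random) saddle point.
\<close>

section \<open>First-order inequalities for convex functions\<close>

lemma GDERIV_along_line:
  assumes "GDERIV f z :> g"
  shows "((\<lambda>t. (f (z + t *\<^sub>R d) - f z) / t) \<longlongrightarrow> g \<bullet> d) (at_right 0)"
proof -
  have "((\<lambda>t. f (z + t *\<^sub>R d)) has_derivative (\<lambda>t. t *\<^sub>R d \<bullet> g)) (at 0)"
    by (rule has_derivative_compose[where g = f and f = "\<lambda>t. z + t *\<^sub>R d"])
       (use assms in \<open>auto simp: gderiv_def intro!: derivative_eq_intros\<close>)
  then have "((\<lambda>t. f (z + t *\<^sub>R d)) has_field_derivative g \<bullet> d) (at 0)"
    by (simp add: has_field_derivative_def inner_commute[of g d] mult_commute_abs)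
  then have "((\<lambda>t. (f (z + t *\<^sub>R d) - f z) / t) \<longlongrightarrow> g \<bullet> d) (at 0)"
    by (simp add: DERIV_def)
  then show ?thesis
    by (rule filterlim_mono) (auto simp: at_le)
qed

lemma segment_point_mem:
  assumes "convex X" "z \<in> X" "p \<in> X" "0 \<le> t" "t \<le> (1::real)"
  shows "z + t *\<^sub>R (p - z) \<in> X"
proof -
  have "z + t *\<^sub>R (p - z) = (1 - t) *\<^sub>R z + t *\<^sub>R p"
    by (simp add: algebra_simps)
  then show ?thesis
    using assms by (simp add: convex_alt)
qed

text \<open>Strong convexity along the segment from \<open>z\<close> to \<open>p\<close> bounds the difference quotients of \<open>f\<close>
  at \<open>z\<close>; letting the parameter tend to zero turns them into the directional derivative.\<close>

lemma strongly_convex_on_first_order: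
  fixes f :: "'a::real_inner \<Rightarrow> real"
  assumes sc: "strongly_convex_on \<sigma> X f" and X: "convex X" "z \<in> X" "p \<in> X"
    and g: "GDERIV f z :> g"
  shows "f z + g \<bullet> (p - z) + \<sigma> / 2 * (norm (p - z))\<^sup>2 \<le> f p"
proof -
  have "((\<lambda>t. (f (z + t *\<^sub>R (p - z)) - f z) / t + \<sigma> / 2 * (1 - t) * (norm (p - z))\<^sup>2)
      \<longlongrightarrow> g \<bullet> (p - z) + \<sigma> / 2 * (1 - 0) * (norm (p - z))\<^sup>2) (at_right 0)"
    by (intro tendsto_intros GDERIV_along_line g)
  moreover have "\<forall>\<^sub>F t in at_right 0.
      (f (z + t *\<^sub>R (p - z)) - f z) / t + \<sigma> / 2 * (1 - t) * (norm (p - z))\<^sup>2 \<le> f p - f z"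
    using eventually_at_right_real[OF zero_less_one]
  proof eventually_elim
    case (elim t)
    have "f ((1 - t) *\<^sub>R z + t *\<^sub>R p)
        \<le> (1 - t) * f z + t * f p - \<sigma> / 2 * t * (1 - t) * (norm (z - p))\<^sup>2"
      using sc X elim by (simp add: strongly_convex_on_def closed_segment_subset)
    moreover have "(1 - t) *\<^sub>R z + t *\<^sub>R p = z + t *\<^sub>R (p - z)"
      by (simp add: algebra_simps)
    ultimately have "f (z + t *\<^sub>R (p - z)) - f z
        \<le> t * (f p - f z - \<sigma> / 2 * (1 - t) * (norm (p - z))\<^sup>2)"
      by (simp add: algebra_simps norm_minus_commute)
    then show ?case
      using elim by (simp add: divide_le_eq field_simps)
  qed
  ultimately have "g \<bullet> (p - z) + \<sigma> / 2 * (1 - 0) * (norm (p - z))\<^sup>2 \<le> f p - f z"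
    by (intro tendsto_upperbound) auto
  then show ?thesis by simp
qed

lemma minimizer_variational_inequality:
  fixes f :: "'a::real_inner \<Rightarrow> real"
  assumes X: "convex X" "z \<in> X" "p \<in> X" and g: "GDERIV f z :> g"
    and min: "\<And>u. u \<in> X \<Longrightarrow> f z \<le> f u"
  shows "0 \<le> g \<bullet> (p - z)"
proof (rule tendsto_lowerbound[OF GDERIV_along_line[OF g]])
  show "\<forall>\<^sub>F t in at_right 0. 0 \<le> (f (z + t *\<^sub>R (p - z)) - f z) / t"
    using eventually_at_right_real[OF zero_less_one]
    by eventually_elim (use X in \<open>auto intro!: divide_nonneg_nonneg min segment_point_mem\<close>)
qed auto

text \<open>Gradients are unique, so the definite description in the definition of the gradient can be
  evaluated from any derivative found by other means.\<close>

lemma grad_eqI: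
  assumes "GDERIV f x :> g"
  shows "grad f x = g"
  unfolding grad_def
proof (rule the_equality)
  show "GDERIV f x :> g" by (rule assms)
next
  fix g' assume "GDERIV f x :> g'"
  then have "(\<lambda>h. h \<bullet> g') = (\<lambda>h. h \<bullet> g)"
    using assms unfolding gderiv_def by (rule has_derivative_unique)
  then have "(g' - g) \<bullet> (g' - g) = 0"
    by (metis inner_diff_right right_minus_eq)
  then show "g' = g" by simp
qed

section \<open>Bregman divergences and the mirror map\<close>

definition bregman :: "('a::real_inner \<Rightarrow> real) \<Rightarrow> 'a \<Rightarrow> 'a \<Rightarrow> real" where
  "bregman f p z = f p - f z - grad f z \<bullet> (p - z)"

text \<open>What the analysis of a mirror step needs from a constraint set and its regularizer.
  The real-valued \<open>r\<close> is the regularizer on the set, where it is finite.\<close>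

locale mirror_geometry =
  fixes X :: "'a::euclidean_space set" and R :: "'a \<Rightarrow> ereal" and r :: "'a \<Rightarrow> real"
    and \<sigma> :: real
  assumes nonempty: "X \<noteq> {}" and convex: "convex X" and compact: "compact X"
    and sigma_pos: "0 < \<sigma>"
    and r_eq: "r = (\<lambda>z. real_of_ereal (R z))"
    and finite: "\<And>z. z \<in> X \<Longrightarrow> R z = ereal (r z)"
    and strongly_convex: "strongly_convex_on \<sigma> X r"
    and gderiv: "\<And>z. z \<in> X \<Longrightarrow> GDERIV r z :> grad r z"
    and continuous_grad: "continuous_on X (grad r)"
begin

lemma ereal_grad_eq: "ereal_grad R = grad r"
  by (simp add: ereal_grad_def r_eq)

lemma continuous_r: "continuous_on X r"
  using gderiv unfolding gderiv_def
  by (intro continuous_at_imp_continuous_on ballI has_derivative_continuous) blast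

lemma bregman_lower_bound:
  assumes "p \<in> X" "z \<in> X"
  shows "\<sigma> / 2 * (norm (p - z))\<^sup>2 \<le> bregman r p z"
  using strongly_convex_on_first_order[OF strongly_convex convex assms(2,1) gderiv[OF assms(2)]]
  by (simp add: bregman_def)

lemma bregman_nonneg: "p \<in> X \<Longrightarrow> z \<in> X \<Longrightarrow> 0 \<le> bregman r p z"
  by (rule order_trans[OF _ bregman_lower_bound]) (use sigma_pos in auto)

lemma continuous_bregman: "continuous_on (X \<times> X) (\<lambda>w. bregman r (fst w) (snd w))"
  unfolding bregman_def
  by (intro continuous_intros continuous_on_compose2[OF continuous_r]
      continuous_on_compose2[OF continuous_grad]) auto

lemma bregman_bounded: "\<exists>B. \<forall>p\<in>X. \<forall>z\<in>X. bregman r p z \<le> B"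
proof -
  have "bounded ((\<lambda>w. bregman r (fst w) (snd w)) ` (X \<times> X))"
    by (intro compact_imp_bounded compact_continuous_image continuous_bregman compact_Times compact)
  then obtain B where "\<And>w. w \<in> X \<times> X \<Longrightarrow> norm (bregman r (fst w) (snd w)) \<le> B"
    unfolding bounded_iff by blast
  then have "norm (bregman r p z) \<le> B" if "p \<in> X" "z \<in> X" for p z
    using that by fastforce
  then show ?thesis
    by (intro exI[of _ B]) (auto dest: abs_le_D1)
qed

text \<open>The maximizer of \<open>z \<bullet> y - r z\<close> over \<open>z \<in> X\<close>; it turns out to be the gradient of the conjugate at
  \<open>y\<close>, that is, the mirror map.\<close>

definition prox :: "'a \<Rightarrow> 'a" where
  "prox y = (SOME z. z \<in> X \<and> (\<forall>u\<in>X. u \<bullet> y - r u \<le> z \<bullet> y - r z))"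

lemma prox_mem: "prox y \<in> X"
  and prox_max: "u \<in> X \<Longrightarrow> u \<bullet> y - r u \<le> prox y \<bullet> y - r (prox y)"
proof -
  have "\<exists>z\<in>X. \<forall>u\<in>X. u \<bullet> y - r u \<le> z \<bullet> y - r z"
    by (rule continuous_attains_sup[OF compact nonempty])
       (rule continuous_on_diff[OF
          continuous_on_inner[OF continuous_on_id continuous_on_const] continuous_r])
  then have "\<exists>z. z \<in> X \<and> (\<forall>u\<in>X. u \<bullet> y - r u \<le> z \<bullet> y - r z)"
    by (simp only: Bex_def)
  from someI_ex[OF this, folded prox_def]
  show "prox y \<in> X" and "u \<in> X \<Longrightarrow> u \<bullet> y - r u \<le> prox y \<bullet> y - r (prox y)"
    by simp_all
qed

lemma prox_variational:
  assumes "p \<in> X"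
  shows "0 \<le> (grad r (prox y) - y) \<bullet> (p - prox y)"
proof (rule minimizer_variational_inequality[OF convex prox_mem assms])
  show "GDERIV (\<lambda>u. r u - u \<bullet> y) (prox y) :> grad r (prox y) - y"
    by (intro GDERIV_diff gderiv prox_mem)
       (simp add: gderiv_def bounded_linear_inner_left bounded_linear_imp_has_derivative)
  show "r (prox y) - prox y \<bullet> y \<le> r u - u \<bullet> y" if "u \<in> X" for u
    using prox_max[OF that, of y] by linarith
qed

text \<open>The objective inherits strong convexity from \<open>r\<close>, so it falls off quadratically away from its
  maximizer. This is what makes the maximizer unique and stable in \<open>y\<close>.\<close>

lemma prox_quadratic_growth:
  assumes "p \<in> X"
  shows "p \<bullet> y - r p + \<sigma> / 2 * (norm (p - prox y))\<^sup>2 \<le> prox y \<bullet> y - r (prox y)"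
  using prox_variational[OF assms, of y] bregman_lower_bound[OF assms prox_mem, of y]
  by (simp add: bregman_def inner_diff inner_commute)

lemma prox_lipschitz: "\<sigma> * norm (prox y' - prox y) \<le> norm (y' - y)"
proof -
  \<comment> \<open>Add the growth inequalities at the two maximizers, each tested against the other.\<close>
  have "\<sigma> * (norm (prox y' - prox y))\<^sup>2 \<le> (prox y' - prox y) \<bullet> (y' - y)"
    using prox_quadratic_growth[OF prox_mem[of y'], of y]
      prox_quadratic_growth[OF prox_mem[of y], of y']
    by (simp add: inner_diff norm_minus_commute)
  also have "\<dots> \<le> norm (prox y' - prox y) * norm (y' - y)"
    by (rule norm_cauchy_schwarz)
  finally have "norm (prox y' - prox y) * (\<sigma> * norm (prox y' - prox y))
      \<le> norm (prox y' - prox y) * norm (y' - y)"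
    by (simp add: power2_eq_square mult_ac)
  then show ?thesis
    by (cases "prox y' = prox y") auto
qed

lemma conjugate_eq:
  "conjugate (\<lambda>z. R z + convex_indicator X z) y = ereal (prox y \<bullet> y - r (prox y))"
proof (unfold conjugate_def, rule SUP_eqI)
  show "ereal (z \<bullet> y) - (R z + convex_indicator X z) \<le> ereal (prox y \<bullet> y - r (prox y))" for z
    using prox_max[of z y] finite[of z] by (cases "z \<in> X") (auto simp: convex_indicator_def)
  show "ereal (prox y \<bullet> y - r (prox y)) \<le> b"
    if "\<And>z. z \<in> UNIV \<Longrightarrow> ereal (z \<bullet> y) - (R z + convex_indicator X z) \<le> b" for b
    using that[of "prox y"] finite[OF prox_mem] prox_mem by (auto simp: convex_indicator_def)
qed

text \<open>The conjugate is a maximum of affine functions of \<open>y\<close>. The affine function that attains the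
  maximum at \<open>y\<close> is a minorant with gradient \<open>prox y\<close>, the one that attains it at \<open>y'\<close> bounds
  the excess by \<open>(prox y' - prox y) \<bullet> (y' - y)\<close>, and this is of second order since \<open>prox\<close> is
  Lipschitz.\<close>

lemma GDERIV_conjugate:
  "GDERIV (\<lambda>y. prox y \<bullet> y - r (prox y)) y :> prox y"
proof -
  let ?\<phi> = "\<lambda>y. prox y \<bullet> y - r (prox y)"
  have "norm (?\<phi> y' - ?\<phi> y - (y' - y) \<bullet> prox y) / norm (y' - y) \<le> norm (y' - y) / \<sigma>" for y'
  proof -
    have "0 \<le> ?\<phi> y' - ?\<phi> y - (y' - y) \<bullet> prox y"
      using prox_max[OF prox_mem[of y], of y'] by (simp add: inner_diff inner_commute)
    moreover have "?\<phi> y' - ?\<phi> y - (y' - y) \<bullet> prox y \<le> (prox y' - prox y) \<bullet> (y' - y)"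
      using prox_max[OF prox_mem[of y'], of y] by (simp add: inner_diff inner_commute)
    moreover have "(prox y' - prox y) \<bullet> (y' - y) \<le> norm (prox y' - prox y) * norm (y' - y)"
      by (rule norm_cauchy_schwarz)
    moreover have "norm (prox y' - prox y) * norm (y' - y) \<le> norm (y' - y) / \<sigma> * norm (y' - y)"
      using prox_lipschitz[of y' y] sigma_pos
      by (intro mult_right_mono) (auto simp: field_simps)
    ultimately have "norm (?\<phi> y' - ?\<phi> y - (y' - y) \<bullet> prox y) \<le> norm (y' - y) / \<sigma> * norm (y' - y)"
      by auto
    then show ?thesis
      using sigma_pos by (cases "y' = y") (auto simp: divide_le_eq)
  qed
  moreover have "((\<lambda>y'. norm (y' - y) / \<sigma>) \<longlongrightarrow> norm (y - y) / \<sigma>) (at y)"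
    by (intro tendsto_intros) (use sigma_pos in auto)
  ultimately have "((\<lambda>y'. norm (?\<phi> y' - ?\<phi> y - (y' - y) \<bullet> prox y) / norm (y' - y)) \<longlongrightarrow> 0) (at y)"
    by - (rule tendsto_sandwich[where f = "\<lambda>_. 0" and h = "\<lambda>y'. norm (y' - y) / \<sigma>"],
        auto)
  then show ?thesis
    unfolding gderiv_def has_derivative_iff_norm by (simp add: bounded_linear_inner_left)
qed

lemma mirror_map_eq_prox: "mirror_map X R = prox"
  by (simp add: fun_eq_iff mirror_map_def ereal_grad_def conjugate_eq grad_eqI[OF GDERIV_conjugate])

lemma mirror_map_mem: "mirror_map X R y \<in> X"
  by (simp add: mirror_map_eq_prox prox_mem)

lemma continuous_mirror_map: "continuous_on UNIV (mirror_map X R)"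
proof -
  have "(1 / \<sigma>)-lipschitz_on UNIV prox"
    using prox_lipschitz sigma_pos
    by (intro lipschitz_onI) (auto simp: dist_norm field_simps)
  then show ?thesis
    unfolding mirror_map_eq_prox by (rule lipschitz_on_continuous_on)
qed

text \<open>The basic inequality of mirror descent. The variational inequality for the new point, expanded by
  the three-point identity of Bregman divergences, leaves the cross term \<open>a (G \<bullet> (z - z'))\<close>; the
  divergence between new and old point absorbs it up to the quadratic error. Negative \<open>a\<close> gives the
  ascent step.\<close>

lemma mirror_step_bregman:
  fixes a :: real
  assumes z: "z \<in> X" and p: "p \<in> X"
  shows "bregman r p (mirror_map X R (grad r z - a *\<^sub>R G))
    \<le> bregman r p z + a * (G \<bullet> (p - z)) + a\<^sup>2 / (2 * \<sigma>) * (norm G)\<^sup>2"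
proof -
  define z' where "z' = mirror_map X R (grad r z - a *\<^sub>R G)"
  have "0 \<le> (grad r z' - (grad r z - a *\<^sub>R G)) \<bullet> (p - z')"
    using prox_variational[OF p] by (simp add: z'_def mirror_map_eq_prox)
  then have "bregman r p z' \<le> bregman r p z - bregman r z' z + a * (G \<bullet> (p - z)) + a * (G \<bullet> (z - z'))"
    by (simp add: bregman_def inner_diff algebra_simps)
  moreover have "\<sigma> / 2 * (norm (z - z'))\<^sup>2 \<le> bregman r z' z"
    using bregman_lower_bound[OF mirror_map_mem z] by (simp add: z'_def norm_minus_commute)
  moreover have "a * (G \<bullet> (z - z')) \<le> a\<^sup>2 / (2 * \<sigma>) * (norm G)\<^sup>2 + \<sigma> / 2 * (norm (z - z'))\<^sup>2"
  proof -
    \<comment> \<open>Young's inequality with weight \<open>\<sigma>\<close>, as a completed square.\<close>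
    have "0 \<le> (norm (a *\<^sub>R G - \<sigma> *\<^sub>R (z - z')))\<^sup>2 / (2 * \<sigma>)"
      using sigma_pos by simp
    also have "\<dots> = a\<^sup>2 / (2 * \<sigma>) * (norm G)\<^sup>2 + \<sigma> / 2 * (norm (z - z'))\<^sup>2 - a * (G \<bullet> (z - z'))"
      using sigma_pos
      unfolding power2_norm_eq_inner inner_diff_left[of "a *\<^sub>R G"] inner_diff_right[of _ "a *\<^sub>R G"]
        inner_scaleR_left inner_scaleR_right inner_commute[of "z - z'" G]
      by (simp add: field_simps power2_eq_square)
    finally show ?thesis by linarith
  qed
  ultimately show ?thesis
    unfolding z'_def by linarith
qed

end

text \<open>Segments between points of the convex set \<open>X\<close> lie in the
  open set on which the regularizer is strongly convex.\<close>

lemma mirror_regularizer_imp_geometry: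
  fixes X :: "'a::euclidean_space set"
  assumes X: "X \<noteq> {}" "convex X" "compact X" and "0 < \<sigma>"
    and R: "mirror_regularizer \<sigma> \<rho> X R"
  shows "mirror_geometry X R (\<lambda>z. real_of_ereal (R z)) \<sigma>"
proof -
  obtain D where D: "X \<subseteq> D" "\<forall>z\<in>D. \<bar>R z\<bar> \<noteq> \<infinity>"
      "C2_on D (\<lambda>z. real_of_ereal (R z))"
      "strongly_convex_on \<sigma> D (\<lambda>z. real_of_ereal (R z))" "\<rho>-lipschitz_on D (ereal_grad R)"
    using R unfolding mirror_regularizer_def by (elim exE conjE)
  show ?thesis
  proof
    show "strongly_convex_on \<sigma> X (\<lambda>z. real_of_ereal (R z))"
      using D(1,4) unfolding strongly_convex_on_def by blast
    show "continuous_on X (grad (\<lambda>z. real_of_ereal (R z)))"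
      using continuous_on_subset[OF lipschitz_on_continuous_on[OF D(5)] D(1)]
      by (simp only: ereal_grad_def)
    show "R z = ereal (real_of_ereal (R z))" if "z \<in> X" for z
      using subsetD[OF D(1) that] D(2) by (simp add: ereal_real)
    show "GDERIV (\<lambda>z. real_of_ereal (R z)) z :> grad (\<lambda>z. real_of_ereal (R z)) z"
      if "z \<in> X" for z
      using D(1,3) that unfolding C2_on_def by blast
  qed (simp_all add: assms)
qed

section \<open>Almost sure convergence of bounded almost-supermartingales\<close>

text \<open>Doob's trading strategy on a price path \<open>u\<close>: buy when the price is at most \<open>a\<close>, sell when it
  is at least \<open>b\<close>. The value says whether the asset is held from time \<open>n\<close> to \<open>n + 1\<close>.\<close>

primrec holding :: "real \<Rightarrow> real \<Rightarrow> (nat \<Rightarrow> real) \<Rightarrow> nat \<Rightarrow> bool" where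
  "holding a b u 0 \<longleftrightarrow> u 0 \<le> a"
| "holding a b u (Suc n) \<longleftrightarrow> (if holding a b u n then u (Suc n) < b else u (Suc n) \<le> a)"

text \<open>Every completed sale earns at least \<open>b - a\<close>, and since prices are nonnegative an asset that is
  still held has lost at most its purchase price, which is at most \<open>a\<close>.\<close>

lemma upcrossing_gain:
  assumes "\<And>n. 0 \<le> u n" "a < b" "0 \<le> a"
  shows "(b - a) * (\<Sum>n<N. of_bool (holding a b u n \<and> \<not> holding a b u (Suc n))) - a
    \<le> (\<Sum>n<N. of_bool (holding a b u n) * (u (Suc n) - u n))"
proof -
  define C :: "nat \<Rightarrow> real"
    where "C N = (\<Sum>n<N. of_bool (holding a b u n \<and> \<not> holding a b u (Suc n)))" for N
  define Y where "Y N = (\<Sum>n<N. of_bool (holding a b u n) * (u (Suc n) - u n))" for N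
  have rec: "C (Suc N) = C N + of_bool (holding a b u N \<and> \<not> holding a b u (Suc N))"
    "Y (Suc N) = Y N + of_bool (holding a b u N) * (u (Suc N) - u N)" for N
    by (simp_all add: C_def Y_def del: holding.simps)
  \<comment> \<open>An asset held at time \<open>N\<close> was bought for at most \<open>a\<close>, so its paper gain is at least \<open>u N - a\<close>.\<close>
  have "(b - a) * C N + (if holding a b u N then u N - a else 0) \<le> Y N"
  proof (induction N)
    case 0
    then show ?case by (simp add: C_def Y_def)
  next
    case (Suc N)
    then show ?case
      using assms by (auto simp: rec algebra_simps split: if_splits)
  qed
  moreover have "- a \<le> (if holding a b u N then u N - a else 0)"
    using assms by auto
  ultimately show ?thesis
    unfolding C_def Y_def by linarith
qed

text \<open>After the last sale the strategy either holds forever, as the price never reaches \<open>b\<close>, or is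
  out of the market forever, as the price never comes down to \<open>a\<close>.\<close>

lemma finite_sales_imp_separated:
  assumes "\<forall>\<^sub>F n in sequentially. \<not> (holding a b u n \<and> \<not> holding a b u (Suc n))"
  shows "(\<forall>\<^sub>F n in sequentially. u n < b) \<or> (\<forall>\<^sub>F n in sequentially. a < u n)"
proof -
  obtain N where N: "\<And>n. N \<le> n \<Longrightarrow> holding a b u n \<Longrightarrow> holding a b u (Suc n)"
    using assms unfolding eventually_sequentially by blast
  show ?thesis
  proof (cases "\<exists>m\<ge>N. holding a b u m")
    case True
    then obtain m where m: "N \<le> m" "holding a b u m" by blast
    have "holding a b u n" if "m \<le> n" for n
      using that by (induction n rule: dec_induct) (use m N in auto)
    then have "u (Suc n) < b" if "m \<le> n" for n
      using holding.simps(2)[of a b u n] that by (metis le_Suc_eq)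
    then show ?thesis
      by (auto simp: eventually_sequentially intro!: exI[of _ "Suc m"] dest: Suc_le_D)
  next
    case False
    then have "a < u (Suc n)" if "N \<le> n" for n
      using holding.simps(2)[of a b u n] that by (meson le_SucI not_le)
    then show ?thesis
      by (auto simp: eventually_sequentially intro!: exI[of _ "Suc N"] dest: Suc_le_D)
  qed
qed

lemma convergent_if_no_crossing:
  fixes u :: "nat \<Rightarrow> real"
  assumes bdd: "\<And>n. 0 \<le> u n" "\<And>n. u n \<le> B"
    and sep: "\<And>a b. a \<in> \<rat> \<Longrightarrow> b \<in> \<rat> \<Longrightarrow> 0 \<le> a \<Longrightarrow> a < b \<Longrightarrow>
      (\<forall>\<^sub>F n in sequentially. u n < b) \<or> (\<forall>\<^sub>F n in sequentially. a < u n)"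
  shows "convergent u"
proof -
  let ?u = "\<lambda>n. ereal (u n)"
  have lim: "liminf ?u = limsup ?u"
  proof (rule ccontr)
    assume "liminf ?u \<noteq> limsup ?u"
    then have less: "liminf ?u < limsup ?u"
      using Liminf_le_Limsup[of sequentially ?u] by (simp add: order.not_eq_order_implies_strict)
    have nonneg: "0 \<le> liminf ?u"
      by (rule Liminf_bounded) (use bdd in auto)
    obtain c where c: "liminf ?u < ereal c" "ereal c < limsup ?u"
      using ereal_dense2[OF less] by blast
    obtain d where d: "ereal c < ereal d" "ereal d < limsup ?u"
      using ereal_dense2[OF c(2)] by blast
    obtain a where a: "a \<in> \<rat>" "c < a" "a < d"
      using Rats_dense_in_real[of c d] d(1) by auto
    obtain b where b: "b \<in> \<rat>" "a < b" "b < d"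
      using Rats_dense_in_real[of a d] a by auto
    have "0 \<le> a"
      using nonneg c(1) a(2) by (metis ereal_less_eq(5) le_less_trans less_ereal.simps(1)
          order.strict_implies_order order_le_less_trans)
    with sep[of a b] a b consider "\<forall>\<^sub>F n in sequentially. u n < b" | "\<forall>\<^sub>F n in sequentially. a < u n"
      by blast
    then show False
    proof cases
      case 1
      then have "limsup ?u \<le> ereal b"
        by (intro Limsup_bounded) (auto elim: eventually_mono)
      then show False using d(2) b(3) by (metis ereal_less_eq(3) leD less_le_trans order_less_imp_le)
    next
      case 2
      then have "ereal a \<le> liminf ?u"
        by (intro Liminf_bounded) (auto elim: eventually_mono)
      then show False using c(1) a(2) by (metis ereal_less_eq(3) leD less_le_trans order_less_imp_le)
    qed
  qed
  have "limsup ?u \<le> ereal B" "0 \<le> liminf ?u"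
    by (auto intro!: Limsup_bounded Liminf_bounded simp: bdd)
  then obtain l where "limsup ?u = ereal l"
    using lim by (cases "limsup ?u") auto
  then have "?u \<longlonglongrightarrow> ereal l"
    using lim by (intro Liminf_eq_Limsup) auto
  then show ?thesis
    by (auto simp: convergent_def)
qed

text \<open>A form of the Robbins-Siegmund theorem in which the conditional drift inequality is tested against
  the events of the filtration, so that no conditional expectation of \<open>V\<close> has to be formed. Two
  choices of events suffice. The whole space telescopes and bounds the expected total of \<open>h\<close>. The
  events that Doob's strategy holds the asset bound the expected number of sales between
  \<open>a < b\<close>; by Borel-Cantelli there are almost surely finitely many, for all rational
  \<open>a < b\<close> at once, so \<open>V\<close> cannot oscillate.\<close>

lemma robbins_siegmund_bounded:
  fixes V h :: "nat \<Rightarrow> 'w \<Rightarrow> real" and c :: "nat \<Rightarrow> real" and F :: "nat \<Rightarrow> 'w measure"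
  assumes M: "prob_space M"
    and sub: "\<And>n. subalgebra M (F n)"
    and mono: "\<And>m n. m \<le> n \<Longrightarrow> sets (F m) \<subseteq> sets (F n)"
    and V: "\<And>n. V n \<in> borel_measurable (F n)"
    and V_bounds: "\<And>n \<omega>. \<omega> \<in> space M \<Longrightarrow> 0 \<le> V n \<omega> \<and> V n \<omega> \<le> B"
    and h: "\<And>n. integrable M (h n)" and h_nonneg: "\<And>n \<omega>. \<omega> \<in> space M \<Longrightarrow> 0 \<le> h n \<omega>"
    and c: "summable c" "\<And>n. 0 \<le> c n"
    and drift: "\<And>n A. A \<in> sets (F n) \<Longrightarrow>
      (\<integral>\<omega>. indicator A \<omega> * (V (Suc n) \<omega> - V n \<omega> + h n \<omega>) \<partial>M) \<le> c n"
  shows "AE \<omega> in M. convergent (\<lambda>n. V n \<omega>) \<and> summable (\<lambda>n. h n \<omega>)"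
proof -
  interpret prob_space M by (rule M)
  have space_F: "space (F n) = space M" for n
    using sub by (simp add: subalgebra_def)
  have V_M[measurable]: "V n \<in> borel_measurable M" for n
    using measurable_from_subalg[OF sub V] .
  have V_F: "V m \<in> borel_measurable (F n)" if "m \<le> n" for m n
    by (rule measurable_from_subalg[OF _ V]) (simp add: subalgebra_def space_F mono that)
  have int_V[simp]: "integrable M (V n)" for n
    by (rule integrable_const_bound[of _ B]) (use V_bounds in auto)
  have int_step: "integrable M (\<lambda>\<omega>. indicator A \<omega> * (V (Suc n) \<omega> - V n \<omega> + h n \<omega>))"
    if "A \<in> sets M" for A n
    using integrable_mult_indicator[OF that, of "\<lambda>\<omega>. V (Suc n) \<omega> - V n \<omega> + h n \<omega>"] h by simp
  have sum_c: "(\<Sum>n<N. c n) \<le> suminf c" for N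
    using c by (intro sum_le_suminf) auto
  have gain: "(\<integral>\<omega>. (\<Sum>n<N. indicator (A n) \<omega> * (V (Suc n) \<omega> - V n \<omega> + h n \<omega>)) \<partial>M) \<le> suminf c"
    if A: "\<And>n. A n \<in> sets (F n)" for A N
  proof -
    have [measurable]: "A n \<in> sets M" for n
      using A sub by (auto simp: subalgebra_def)
    have "(\<integral>\<omega>. (\<Sum>n<N. indicator (A n) \<omega> * (V (Suc n) \<omega> - V n \<omega> + h n \<omega>)) \<partial>M)
        = (\<Sum>n<N. \<integral>\<omega>. indicator (A n) \<omega> * (V (Suc n) \<omega> - V n \<omega> + h n \<omega>) \<partial>M)"
      by (intro Bochner_Integration.integral_sum int_step) simp
    also have "\<dots> \<le> (\<Sum>n<N. c n)"
      by (intro sum_mono drift A)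
    finally show ?thesis using sum_c[of N] by linarith
  qed

  have "AE \<omega> in M. summable (\<lambda>n. h n \<omega>)"
  proof -
    have bound: "(\<Sum>n<N. \<integral>\<omega>. h n \<omega> \<partial>M) \<le> suminf c + B" for N
    proof -
      have "(\<Sum>n<N. \<integral>\<omega>. h n \<omega> \<partial>M) - B = (\<integral>\<omega>. (\<Sum>n<N. h n \<omega>) - B \<partial>M)"
        by (simp add: h prob_space)
      also have "\<dots> \<le> (\<integral>\<omega>. (\<Sum>n<N. indicator (space M) \<omega> * (V (Suc n) \<omega> - V n \<omega> + h n \<omega>)) \<partial>M)"
      proof (rule integral_mono)
        fix \<omega> assume \<omega>: "\<omega> \<in> space M"
        have "(\<Sum>n<N. V (Suc n) \<omega> - V n \<omega>) = V N \<omega> - V 0 \<omega>"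
          by (rule sum_lessThan_telescope)
        then show "(\<Sum>n<N. h n \<omega>) - B
            \<le> (\<Sum>n<N. indicator (space M) \<omega> * (V (Suc n) \<omega> - V n \<omega> + h n \<omega>))"
          using V_bounds[OF \<omega>, of N] V_bounds[OF \<omega>, of 0] \<omega> by (simp add: sum.distrib)
      next
        show "integrable M (\<lambda>\<omega>. (\<Sum>n<N. h n \<omega>) - B)"
          by (simp add: h)
      qed (intro Bochner_Integration.integrable_sum int_step sets.top)
      also have "\<dots> \<le> suminf c"
        by (rule gain) (metis sets.top space_F)
      finally show ?thesis by linarith
    qed
    have "summable (\<lambda>n. \<integral>\<omega>. h n \<omega> \<partial>M)"
      by (rule summableI_nonneg_bounded[OF _ bound]) (auto intro!: integral_nonneg_AE h_nonneg)
    then have "(\<Sum>n. ennreal (\<integral>\<omega>. h n \<omega> \<partial>M)) \<noteq> \<infinity>"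
      by (subst suminf_ennreal2) (auto intro!: integral_nonneg_AE h_nonneg)
    moreover have "(\<integral>\<^sup>+\<omega>. (\<Sum>n. ennreal (h n \<omega>)) \<partial>M) = (\<Sum>n. ennreal (\<integral>\<omega>. h n \<omega> \<partial>M))"
      using h by (subst nn_integral_suminf) (auto simp: nn_integral_eq_integral h_nonneg)
    ultimately have "AE \<omega> in M. (\<Sum>n. ennreal (h n \<omega>)) \<noteq> \<infinity>"
      using h by (intro nn_integral_PInf_AE) auto
    then show ?thesis
      using AE_space by eventually_elim (auto intro: summable_suminf_not_top h_nonneg)
  qed

  moreover have "AE \<omega> in M. \<forall>(a, b) \<in> {(a, b). a \<in> \<rat> \<and> b \<in> \<rat> \<and> 0 \<le> a \<and> a < b}.
      (\<forall>\<^sub>F n in sequentially. V n \<omega> < b) \<or> (\<forall>\<^sub>F n in sequentially. a < V n \<omega>)"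
  proof (subst AE_ball_countable)
    show "countable {(a, b). a \<in> \<rat> \<and> b \<in> \<rat> \<and> 0 \<le> a \<and> a < (b::real)}"
      by (rule countable_subset[of _ "\<rat> \<times> \<rat>"]) (auto intro: countable_rat)
    have "AE \<omega> in M. (\<forall>\<^sub>F n in sequentially. V n \<omega> < b) \<or> (\<forall>\<^sub>F n in sequentially. a < V n \<omega>)"
      if ab: "0 \<le> a" "a < b" for a b
    proof -
      define H where "H n = {\<omega>\<in>space M. holding a b (\<lambda>k. V k \<omega>) n}" for n
      define C where "C n = H n - H (Suc n)" for n
      have "{\<omega>\<in>space (F n). holding a b (\<lambda>k. V k \<omega>) m} \<in> sets (F n)" if "m \<le> n" for m n
        using that
      proof (induction m)
        case 0
        note [measurable] = V_F[OF 0]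
        show ?case by simp
      next
        case (Suc m)
        note [measurable] = V_F[OF Suc.prems] Suc.IH[OF Suc_leD[OF Suc.prems]]
        have [measurable]: "Measurable.pred (F n) (\<lambda>\<omega>. holding a b (\<lambda>k. V k \<omega>) m)"
          using Suc.IH[OF Suc_leD[OF Suc.prems]] by (simp add: pred_def)
        show ?case by simp
      qed
      then have H: "H n \<in> sets (F n)" for n
        unfolding H_def by (simp add: space_F)
      then have [measurable]: "H n \<in> sets M" for n
        using sub by (auto simp: subalgebra_def)
      have [measurable]: "C n \<in> sets M" for n
        unfolding C_def by simp
      have "(\<Sum>n<N. prob (C n)) \<le> (suminf c + a) / (b - a)" for N
      proof -
        have "(b - a) * (\<Sum>n<N. prob (C n)) - a
            = (\<integral>\<omega>. (b - a) * (\<Sum>n<N. indicator (C n) \<omega>) - a \<partial>M)"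
          by (simp add: prob_space integrable_real_indicator emeasure_eq_measure)
        also have "\<dots> \<le> (\<integral>\<omega>. (\<Sum>n<N. indicator (H n) \<omega> * (V (Suc n) \<omega> - V n \<omega> + h n \<omega>)) \<partial>M)"
        proof (rule integral_mono)
          fix \<omega> assume \<omega>: "\<omega> \<in> space M"
          have "(b - a) * (\<Sum>n<N. indicator (C n) \<omega>) - a
              \<le> (\<Sum>n<N. indicator (H n) \<omega> * (V (Suc n) \<omega> - V n \<omega>))"
            using upcrossing_gain[of "\<lambda>n. V n \<omega>" a b N] ab V_bounds[OF \<omega>] \<omega>
            by (simp add: C_def H_def indicator_def of_bool_def del: holding.simps)
          also have "\<dots> \<le> (\<Sum>n<N. indicator (H n) \<omega> * (V (Suc n) \<omega> - V n \<omega> + h n \<omega>))"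
            using h_nonneg[OF \<omega>] by (intro sum_mono mult_left_mono) auto
          finally show "(b - a) * (\<Sum>n<N. indicator (C n) \<omega>) - a
              \<le> (\<Sum>n<N. indicator (H n) \<omega> * (V (Suc n) \<omega> - V n \<omega> + h n \<omega>))" .
        next
          show "integrable M (\<lambda>\<omega>. (b - a) * (\<Sum>n<N. indicator (C n) \<omega>) - a)"
            by (auto intro!: integrable_real_indicator simp: emeasure_eq_measure)
        qed (intro Bochner_Integration.integrable_sum int_step, simp)
        also have "\<dots> \<le> suminf c"
          by (rule gain[OF H])
        finally show ?thesis
          using ab by (simp add: field_simps)
      qed
      then have "summable (\<lambda>n. prob (C n))"
        by (intro summableI_nonneg_bounded) auto
      then have "AE \<omega> in M. \<forall>\<^sub>F n in sequentially. \<omega> \<in> space M - C n"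
        by (intro borel_cantelli_AE1) (auto simp: emeasure_eq_measure)
      then show ?thesis
      proof (rule AE_mp, intro AE_I2 impI)
        fix \<omega> assume "\<omega> \<in> space M" and ev: "\<forall>\<^sub>F n in sequentially. \<omega> \<in> space M - C n"
        from ev have "\<forall>\<^sub>F n in sequentially.
            \<not> (holding a b (\<lambda>k. V k \<omega>) n \<and> \<not> holding a b (\<lambda>k. V k \<omega>) (Suc n))"
          by eventually_elim (auto simp: C_def H_def simp del: holding.simps)
        then show "(\<forall>\<^sub>F n in sequentially. V n \<omega> < b) \<or> (\<forall>\<^sub>F n in sequentially. a < V n \<omega>)"
          by (rule finite_sales_imp_separated)
      qed
    qed
    then show "\<forall>ab\<in>{(a, b). a \<in> \<rat> \<and> b \<in> \<rat> \<and> 0 \<le> a \<and> a < b}. AE \<omega> in M.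
        case ab of (a, b) \<Rightarrow> (\<forall>\<^sub>F n in sequentially. V n \<omega> < b) \<or> (\<forall>\<^sub>F n in sequentially. a < V n \<omega>)"
      by auto
  qed
  ultimately show ?thesis
    using AE_space
  proof eventually_elim
    case (elim \<omega>)
    then show ?case
      using V_bounds by (intro conjI convergent_if_no_crossing[of _ B]) auto
  qed
qed

section \<open>The deterministic limit argument\<close>

text \<open>A sequence with summable \<open>\<alpha>\<close>-weighted values cannot stay away from zero, and neither can a finite
  sum of such sequences. Choosing indices at which the first \<open>m + 1\<close> sequences have a small sum
  produces one subsequence that works for all of them.\<close>

lemma common_vanishing_subsequence:
  fixes \<alpha> :: "nat \<Rightarrow> real" and f :: "nat \<Rightarrow> nat \<Rightarrow> real"
  assumes \<alpha>: "\<And>n. 0 \<le> \<alpha> n" "filterlim (\<lambda>N. \<Sum>n<N. \<alpha> n) at_top sequentially"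
    and f: "\<And>k n. 0 \<le> f k n" "\<And>k. summable (\<lambda>n. \<alpha> n * f k n)"
  shows "\<exists>s. strict_mono s \<and> (\<forall>k. (\<lambda>j. f k (s j)) \<longlonglongrightarrow> 0)"
proof -
  have small: "\<exists>n\<ge>N. (\<Sum>k\<le>m. f k n) < 1 / Suc m" for m N
  proof (rule ccontr)
    assume "\<not> ?thesis"
    then have large: "1 \<le> Suc m * (\<Sum>k\<le>m. f k n)" if "N \<le> n" for n
      using that by (force simp: field_simps not_less)
    have "summable (\<lambda>n. Suc m * (\<Sum>k\<le>m. \<alpha> n * f k n))"
      by (intro summable_mult summable_sum f)
    then have "summable \<alpha>"
    proof (rule summable_comparison_test'[where N = N])
      show "norm (\<alpha> n) \<le> Suc m * (\<Sum>k\<le>m. \<alpha> n * f k n)" if "N \<le> n" for n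
        using mult_left_mono[OF large[OF that] \<alpha>(1)[of n]] \<alpha>(1)[of n]
        by (simp add: sum_distrib_left mult_ac)
    qed
    then show False
      using summable_LIMSEQ not_tendsto_and_filterlim_at_infinity
        filterlim_at_top_imp_at_infinity[OF \<alpha>(2)] sequentially_bot by blast
  qed
  have "\<exists>s. \<forall>m. (\<Sum>k\<le>m. f k (s m)) < 1 / Suc m \<and> s m < s (Suc m)"
  proof (rule dependent_nat_choice)
    show "\<exists>n. (\<Sum>k\<le>0. f k n) < 1 / Suc 0"
      using small[of 0 0] by blast
    show "\<exists>n'. (\<Sum>k\<le>Suc m. f k n') < 1 / Suc (Suc m) \<and> n < n'" for n m
      using small[of "Suc n" "Suc m"] by (auto simp: Suc_le_eq)
  qed
  then obtain s where s: "\<And>m. (\<Sum>k\<le>m. f k (s m)) < 1 / Suc m" "\<And>m. s m < s (Suc m)"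
    by blast
  have "(\<lambda>j. f k (s j)) \<longlonglongrightarrow> 0" for k
  proof (rule tendsto_sandwich[of "\<lambda>_. 0" _ _ "\<lambda>j. 1 / real (Suc j)"])
    show "\<forall>\<^sub>F j in sequentially. f k (s j) \<le> 1 / Suc j"
      using eventually_ge_at_top[of k]
    proof eventually_elim
      case (elim j)
      then have "f k (s j) \<le> (\<Sum>k\<le>j. f k (s j))"
        by (intro member_le_sum) (auto simp: f)
      then show ?case using s(1)[of j] by linarith
    qed
    show "(\<lambda>j. 1 / real (Suc j)) \<longlonglongrightarrow> 0"
      by (rule lim_1_over_n[THEN LIMSEQ_Suc])
  qed (auto simp: f)
  then show ?thesis
    using s(2) by (auto simp: strict_mono_Suc_iff)
qed

text \<open>Here \<open>D\<close> is a divergence that dominates the squared distance, and \<open>h s\<close> measures the failure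
  to be optimal as seen from \<open>s \<in> S\<close>. The hypotheses on the sequence concern only the countable
  dense set \<open>T\<close>, because in the application each \<open>s\<close> comes with its own null set; continuity of
  \<open>D\<close> and \<open>h\<close> in the first argument transfers what is needed to all of \<open>S\<close>.\<close>

lemma quasi_fejer_convergence:
  fixes z :: "nat \<Rightarrow> 'a::metric_space" and D h :: "'a \<Rightarrow> 'a \<Rightarrow> real"
  assumes K: "compact K" "\<And>n. z n \<in> K"
    and S: "S \<subseteq> K" and T: "countable T" "T \<noteq> {}" "T \<subseteq> S" "S \<subseteq> closure T"
    and D: "continuous_on (K \<times> K) (\<lambda>w. D (fst w) (snd w))" "\<And>p. p \<in> K \<Longrightarrow> D p p = 0"
      "0 < c" "\<And>p q. p \<in> K \<Longrightarrow> q \<in> K \<Longrightarrow> c * (dist p q)\<^sup>2 \<le> D p q"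
    and h: "continuous_on (K \<times> K) (\<lambda>w. h (fst w) (snd w))"
      "\<And>s q. s \<in> S \<Longrightarrow> q \<in> K \<Longrightarrow> 0 \<le> h s q"
      "\<And>q. q \<in> K \<Longrightarrow> (\<And>s. s \<in> S \<Longrightarrow> h s q = 0) \<Longrightarrow> q \<in> S"
    and \<alpha>: "\<And>n. 0 \<le> \<alpha> n" "filterlim (\<lambda>N. \<Sum>n<N. \<alpha> n) at_top sequentially"
    and conv: "\<And>s. s \<in> T \<Longrightarrow> convergent (\<lambda>n. D s (z n))"
    and gap: "\<And>s. s \<in> T \<Longrightarrow> summable (\<lambda>n. \<alpha> n * h s (z n))"
  shows "\<exists>q\<in>S. z \<longlonglongrightarrow> q"
proof -
  have right: "(\<lambda>n. f p (w n)) \<longlonglongrightarrow> f p q"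
    if "continuous_on (K \<times> K) (\<lambda>w. f (fst w) (snd w))" "p \<in> K" "q \<in> K"
      "w \<longlonglongrightarrow> q" "\<And>n. w n \<in> K" for f :: "'a \<Rightarrow> 'a \<Rightarrow> real" and w p q
    using continuous_on_tendsto_compose[OF that(1) tendsto_Pair[OF tendsto_const[of p] that(4)]] that
    by simp
  have left: "(\<lambda>n. f (w n) q) \<longlonglongrightarrow> f p q"
    if "continuous_on (K \<times> K) (\<lambda>w. f (fst w) (snd w))" "p \<in> K" "q \<in> K"
      "w \<longlonglongrightarrow> p" "\<And>n. w n \<in> K" for f :: "'a \<Rightarrow> 'a \<Rightarrow> real" and w p q
    using continuous_on_tendsto_compose[OF that(1) tendsto_Pair[OF that(4) tendsto_const[of q]]] that
    by simp
  define t where "t = from_nat_into T"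
  have t: "t k \<in> T" for k
    using T(2) by (simp add: t_def from_nat_into)
  have "\<exists>s. strict_mono s \<and> (\<forall>k. (\<lambda>j. h (t k) (z (s j))) \<longlonglongrightarrow> 0)"
    using t T(3) K(2) by (intro common_vanishing_subsequence[OF \<alpha>] gap h(2)) auto
  then obtain s1 where s1: "strict_mono s1" "\<And>k. (\<lambda>j. h (t k) (z (s1 j))) \<longlonglongrightarrow> 0"
    by blast
  obtain q s2 where q: "q \<in> K" "strict_mono s2" "(\<lambda>j. z (s1 (s2 j))) \<longlonglongrightarrow> q"
    using seq_compactE[OF compact_imp_seq_compact[OF K(1)], of "z \<circ> s1"] K(2) by (auto simp: o_def)
  define s where "s = s1 \<circ> s2"
  have s: "strict_mono s" "(\<lambda>j. z (s j)) \<longlonglongrightarrow> q"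
    using q s1 by (auto simp: s_def strict_mono_o)
  have "h p q = 0" if "p \<in> T" for p
  proof -
    obtain k where k: "p = t k"
      using from_nat_into_surj[OF T(1) \<open>p \<in> T\<close>] by (auto simp: t_def)
    have "(\<lambda>j. h p (z (s j))) \<longlonglongrightarrow> h p q"
      by (rule right[OF h(1) _ q(1) s(2) K(2)]) (use that T(3) S in blast)
    moreover have "(\<lambda>j. h p (z (s j))) \<longlonglongrightarrow> 0"
      using LIMSEQ_subseq_LIMSEQ[OF s1(2)[of k] q(2)] by (simp add: k s_def o_def)
    ultimately show ?thesis by (rule LIMSEQ_unique)
  qed
  have "h p q = 0" if p: "p \<in> S" for p
  proof -
    obtain w where w: "\<And>n. w n \<in> T" "w \<longlonglongrightarrow> p"
      using T(4) p closure_sequential by blast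
    have "(\<lambda>n. h (w n) q) \<longlonglongrightarrow> h p q"
      by (rule left[OF h(1) _ q(1) w(2)]) (use w(1) p T(3) S in blast)+
    moreover have "h (w n) q = 0" for n
      using \<open>\<And>p. p \<in> T \<Longrightarrow> h p q = 0\<close> w(1) by blast
    ultimately show ?thesis
      by (simp add: LIMSEQ_const_iff)
  qed
  then have qS: "q \<in> S"
    using h(3) q(1) by blast
  \<comment> \<open>The limit point \<open>q\<close> need not lie in \<open>T\<close>, so compare \<open>z\<close> and \<open>q\<close> through a nearby \<open>p \<in> T\<close>.\<close>
  have "z \<longlonglongrightarrow> q"
  proof (rule metric_LIMSEQ_I)
    fix e :: real assume e: "0 < e"
    define \<delta> where "\<delta> = c * (e / 2)\<^sup>2"
    have \<delta>: "0 < \<delta>" using D(3) e by (simp add: \<delta>_def)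
    have close: "dist p q' < e / 2" if "D p q' < \<delta>" "p \<in> K" "q' \<in> K" for p q'
    proof -
      have "(dist p q')\<^sup>2 < (e / 2)\<^sup>2"
        using le_less_trans[OF D(4)[OF that(2,3)] that(1)] D(3) unfolding \<delta>_def
        by (simp only: mult_less_cancel_left_pos)
      then show ?thesis
        by (rule power_less_imp_less_base) (use e in simp)
    qed
    obtain w where w: "\<And>n. w n \<in> T" "w \<longlonglongrightarrow> q"
      using T(4) qS closure_sequential by blast
    have "(\<lambda>n. D (w n) q) \<longlonglongrightarrow> D q q"
      by (rule left[OF D(1) q(1) q(1) w(2)]) (use w(1) T(3) S in blast)
    then have "\<forall>\<^sub>F n in sequentially. D (w n) q < \<delta>"
      using \<delta> D(2) q(1) by (intro order_tendstoD) auto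
    then obtain p where p: "p \<in> T" "D p q < \<delta>"
      using w(1) by (auto simp: eventually_sequentially)
    have pK: "p \<in> K"
      using p T(3) S by blast
    obtain l where l: "(\<lambda>n. D p (z n)) \<longlonglongrightarrow> l"
      using conv[OF p(1)] by (auto simp: convergent_def)
    have "(\<lambda>j. D p (z (s j))) \<longlonglongrightarrow> D p q"
      by (rule right[OF D(1) pK q(1) s(2) K(2)])
    moreover have "(\<lambda>j. D p (z (s j))) \<longlonglongrightarrow> l"
      using LIMSEQ_subseq_LIMSEQ[OF l s(1)] by (simp add: o_def)
    ultimately have "l = D p q"
      by (rule LIMSEQ_unique[symmetric])
    then have "\<forall>\<^sub>F n in sequentially. D p (z n) < \<delta>"
      using l p(2) by (intro order_tendstoD) auto
    then have "\<forall>\<^sub>F n in sequentially. dist (z n) q < e"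
    proof eventually_elim
      case (elim n)
      have "dist (z n) q \<le> dist p (z n) + dist p q"
        by (rule dist_triangle3)
      then show ?case
        using close[OF elim pK K(2)] close[OF p(2) pK q(1)] by linarith
    qed
    then show "\<exists>N. \<forall>n\<ge>N. dist (z n) q < e"
      by (simp add: eventually_sequentially)
  qed
  then show ?thesis
    using qS by blast
qed

section \<open>Stochastic gradients and conditional expectations\<close>

lemma borel_measurable_continuous_on_compose:
  assumes "z \<in> borel_measurable N" "\<And>\<omega>. \<omega> \<in> space N \<Longrightarrow> z \<omega> \<in> X" "continuous_on X f"
  shows "(\<lambda>\<omega>. f (z \<omega>)) \<in> borel_measurable N"
proof -
  have "z \<in> measurable N (restrict_space borel X)"
    using assms by (intro measurable_restrict_space2) auto
  then show ?thesis
    by (rule measurable_compose[OF _ borel_measurable_continuous_on_restrict[OF assms(3)]])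
qed

lemma second_moment_bound:
  fixes G :: "'w \<Rightarrow> 'a::{real_normed_vector, second_countable_topology}"
  assumes M: "prob_space M" and sub: "subalgebra M F" and G[measurable]: "G \<in> borel_measurable M"
    and K: "0 \<le> K" "AE \<omega> in M. nn_cond_exp M F (\<lambda>\<omega>'. ennreal ((norm (G \<omega>'))\<^sup>2)) \<omega> \<le> ennreal K"
  shows "integrable M (\<lambda>\<omega>. (norm (G \<omega>))\<^sup>2)" "(\<integral>\<omega>. (norm (G \<omega>))\<^sup>2 \<partial>M) \<le> K"
    "integrable M (\<lambda>\<omega>. norm (G \<omega>))"
proof -
  interpret prob_space M by (rule M)
  interpret finite_measure_subalgebra M F
    by unfold_locales (rule sub)
  have "(\<integral>\<^sup>+\<omega>. ennreal ((norm (G \<omega>))\<^sup>2) \<partial>M)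
      = (\<integral>\<^sup>+\<omega>. 1 * nn_cond_exp M F (\<lambda>\<omega>'. ennreal ((norm (G \<omega>'))\<^sup>2)) \<omega> \<partial>M)"
    by (subst nn_cond_exp_intg) auto
  also have "\<dots> \<le> (\<integral>\<^sup>+\<omega>. ennreal K \<partial>M)"
    by (intro nn_integral_mono_AE) (use K in auto)
  finally have bound: "(\<integral>\<^sup>+\<omega>. ennreal ((norm (G \<omega>))\<^sup>2) \<partial>M) \<le> ennreal K"
    by (simp add: emeasure_space_1)
  show int: "integrable M (\<lambda>\<omega>. (norm (G \<omega>))\<^sup>2)"
    by (rule integrableI_nonneg) (use bound in \<open>auto simp: le_less_trans\<close>)
  show "(\<integral>\<omega>. (norm (G \<omega>))\<^sup>2 \<partial>M) \<le> K"
    using bound K(1) by (subst (asm) nn_integral_eq_integral[OF int]) auto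
  show "integrable M (\<lambda>\<omega>. norm (G \<omega>))"
    by (rule square_integrable_imp_integrable) (use int in auto)
qed

text \<open>The defining property of conditional expectation, applied to each coordinate with the bounded
  \<open>F\<close>-measurable factor \<open>W\<close>.\<close>

lemma vec_cond_exp_inner:
  fixes G W :: "'w \<Rightarrow> real ^ 'n"
  assumes M: "prob_space M" and sub: "subalgebra M F"
    and G[measurable]: "G \<in> borel_measurable M" and int: "integrable M (\<lambda>\<omega>. norm (G \<omega>))"
    and W: "W \<in> borel_measurable F" and bdd: "\<And>\<omega>. \<omega> \<in> space M \<Longrightarrow> norm (W \<omega>) \<le> B"
  shows "integrable M (\<lambda>\<omega>. G \<omega> \<bullet> W \<omega>)" "integrable M (\<lambda>\<omega>. vec_cond_exp M F G \<omega> \<bullet> W \<omega>)"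
    "(\<integral>\<omega>. vec_cond_exp M F G \<omega> \<bullet> W \<omega> \<partial>M) = (\<integral>\<omega>. G \<omega> \<bullet> W \<omega> \<partial>M)"
proof -
  interpret prob_space M by (rule M)
  interpret finite_measure_subalgebra M F
    by unfold_locales (rule sub)
  have W_M[measurable]: "W \<in> borel_measurable M"
    using measurable_from_subalg[OF sub W] .
  have Wi: "(\<lambda>\<omega>. W \<omega> $ i) \<in> borel_measurable F" for i
    using W by (rule borel_measurable_continuous_on[OF continuous_on_component[OF continuous_on_id]])
  have Gi: "(\<lambda>\<omega>. G \<omega> $ i) \<in> borel_measurable M" for i
    using G by (rule borel_measurable_continuous_on[OF continuous_on_component[OF continuous_on_id]])
  have int_i: "integrable M (\<lambda>\<omega>. W \<omega> $ i * G \<omega> $ i)" for i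
  proof (rule Bochner_Integration.integrable_bound)
    show "integrable M (\<lambda>\<omega>. B * norm (G \<omega>))"
      using int by simp
    show "(\<lambda>\<omega>. W \<omega> $ i * G \<omega> $ i) \<in> borel_measurable M"
      using measurable_from_subalg[OF sub Wi] Gi by (rule borel_measurable_times)
    have "\<bar>W \<omega> $ i\<bar> * \<bar>G \<omega> $ i\<bar> \<le> B * norm (G \<omega>)" if "\<omega> \<in> space M" for \<omega>
      using bdd[OF that] component_le_norm_cart[of "W \<omega>" i] component_le_norm_cart[of "G \<omega>" i]
      by (intro mult_mono) (auto intro: order_trans norm_ge_zero)
    then show "AE \<omega> in M. norm (W \<omega> $ i * G \<omega> $ i) \<le> norm (B * norm (G \<omega>))"
      by (intro AE_I2, unfold real_norm_def abs_mult[of "W _ $ i"]) (rule order_trans[OF _ abs_ge_self])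
  qed
  note cond = real_cond_exp_intg[OF int_i Wi Gi]
  have expand: "G \<omega> \<bullet> W \<omega> = (\<Sum>i\<in>UNIV. W \<omega> $ i * G \<omega> $ i)"
    "vec_cond_exp M F G \<omega> \<bullet> W \<omega> = (\<Sum>i\<in>UNIV. W \<omega> $ i * real_cond_exp M F (\<lambda>\<omega>'. G \<omega>' $ i) \<omega>)" for \<omega>
    by (simp_all add: inner_vec_def vec_cond_exp_def mult.commute)
  show "integrable M (\<lambda>\<omega>. G \<omega> \<bullet> W \<omega>)"
    unfolding expand by (intro Bochner_Integration.integrable_sum int_i)
  show "integrable M (\<lambda>\<omega>. vec_cond_exp M F G \<omega> \<bullet> W \<omega>)"
    unfolding expand by (intro Bochner_Integration.integrable_sum cond)
  show "(\<integral>\<omega>. vec_cond_exp M F G \<omega> \<bullet> W \<omega> \<partial>M) = (\<integral>\<omega>. G \<omega> \<bullet> W \<omega> \<partial>M)"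
    unfolding expand by (simp add: Bochner_Integration.integral_sum int_i cond)
qed

text \<open>Integrating the basic inequality over a past event \<open>A\<close> replaces the stochastic gradient by its
  conditional expectation, because \<open>p - z\<close> and the indicator of \<open>A\<close> are known to \<open>F\<close>; the
  quadratic error is controlled by the second moment.\<close>

lemma expected_mirror_step:
  fixes X :: "(real ^ 'n) set" and z z' G :: "'w \<Rightarrow> real ^ 'n"
  assumes geo: "mirror_geometry X R r \<sigma>"
    and M: "prob_space M" and sub: "subalgebra M F"
    and z: "z \<in> borel_measurable F" "\<And>\<omega>. \<omega> \<in> space M \<Longrightarrow> z \<omega> \<in> X"
    and z': "\<And>\<omega>. \<omega> \<in> space M \<Longrightarrow> z' \<omega> = mirror_map X R (grad r (z \<omega>) - a *\<^sub>R G \<omega>)"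
      "z' \<in> borel_measurable M"
    and G: "G \<in> borel_measurable M" and K: "0 \<le> K"
      "AE \<omega> in M. nn_cond_exp M F (\<lambda>\<omega>'. ennreal ((norm (G \<omega>'))\<^sup>2)) \<omega> \<le> ennreal K"
    and p: "p \<in> X" and A: "A \<in> sets F"
  defines "\<Delta> \<equiv> \<lambda>\<omega>. bregman r p (z' \<omega>) - bregman r p (z \<omega>)
    - a * (vec_cond_exp M F G \<omega> \<bullet> (p - z \<omega>))"
  shows "integrable M (\<lambda>\<omega>. indicator A \<omega> * \<Delta> \<omega>)"
    and "(\<integral>\<omega>. indicator A \<omega> * \<Delta> \<omega> \<partial>M) \<le> a\<^sup>2 / (2 * \<sigma>) * K"
proof -
  interpret mirror_geometry X R r \<sigma> by (rule geo)
  interpret prob_space M by (rule M)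
  have A_M[measurable]: "A \<in> sets M"
    using A sub by (auto simp: subalgebra_def)
  have z_M: "z \<in> borel_measurable M"
    using measurable_from_subalg[OF sub z(1)] .
  have z'_mem: "z' \<omega> \<in> X" if "\<omega> \<in> space M" for \<omega>
    using that by (simp add: z' mirror_map_mem)
  obtain B where B: "\<And>q. q \<in> X \<Longrightarrow> bregman r p q \<le> B"
    using bregman_bounded p by blast
  have "continuous_on X (\<lambda>q. bregman r (fst (p, q)) (snd (p, q)))"
    by (rule continuous_on_compose2[OF continuous_bregman
          continuous_on_Pair[OF continuous_on_const continuous_on_id]])
       (use p in auto)
  then have cont: "continuous_on X (bregman r p)"
    by simp
  have int_bregman: "integrable M (\<lambda>\<omega>. bregman r p (w \<omega>))"
    if "w \<in> borel_measurable M" "\<And>\<omega>. \<omega> \<in> space M \<Longrightarrow> w \<omega> \<in> X" for w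
    using borel_measurable_continuous_on_compose[OF that cont] B bregman_nonneg[OF p] that(2)
    by (intro integrable_const_bound[of _ B] AE_I2) auto
  define W where "W \<omega> = indicator A \<omega> *\<^sub>R (p - z \<omega>)" for \<omega>
  have W: "W \<in> borel_measurable F"
    using z(1) A unfolding W_def by (intro borel_measurable_scaleR borel_measurable_diff) auto
  obtain C where C: "\<And>q. q \<in> X \<Longrightarrow> norm q \<le> C"
    using compact_imp_bounded[OF compact] by (auto simp: bounded_iff)
  have W_bound: "norm (W \<omega>) \<le> C + C" if "\<omega> \<in> space M" for \<omega>
    using norm_triangle_ineq4[of p "z \<omega>"] C[OF p] C[OF z(2)[OF that]] norm_ge_zero[of p]
    by (auto simp: W_def indicator_def simp del: norm_ge_zero)
  note moment = second_moment_bound[OF M sub G K]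
  note inner = vec_cond_exp_inner[OF M sub G moment(3) W W_bound]
  have \<Delta>_eq: "indicator A \<omega> * \<Delta> \<omega>
      = indicator A \<omega> * (bregman r p (z' \<omega>) - bregman r p (z \<omega>))
        - a * (vec_cond_exp M F G \<omega> \<bullet> W \<omega>)" for \<omega>
    by (simp add: \<Delta>_def W_def algebra_simps)
  have int_diff: "integrable M (\<lambda>\<omega>. indicator A \<omega> * (bregman r p (z' \<omega>) - bregman r p (z \<omega>)))"
    using integrable_mult_indicator[OF A_M Bochner_Integration.integrable_diff[OF
        int_bregman[OF z'(2) z'_mem] int_bregman[OF z_M z(2)]]]
    by simp
  show "integrable M (\<lambda>\<omega>. indicator A \<omega> * \<Delta> \<omega>)"
    unfolding \<Delta>_eq using int_diff inner(2) by simp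
  have "(\<integral>\<omega>. indicator A \<omega> * \<Delta> \<omega> \<partial>M)
      = (\<integral>\<omega>. indicator A \<omega> * (bregman r p (z' \<omega>) - bregman r p (z \<omega>)) - a * (G \<omega> \<bullet> W \<omega>) \<partial>M)"
    unfolding \<Delta>_eq using int_diff inner by simp
  also have "\<dots> \<le> (\<integral>\<omega>. a\<^sup>2 / (2 * \<sigma>) * (norm (G \<omega>))\<^sup>2 \<partial>M)"
  proof (rule integral_mono)
    fix \<omega> assume \<omega>: "\<omega> \<in> space M"
    have "bregman r p (z' \<omega>) - bregman r p (z \<omega>) - a * (G \<omega> \<bullet> (p - z \<omega>))
        \<le> a\<^sup>2 / (2 * \<sigma>) * (norm (G \<omega>))\<^sup>2"
      using mirror_step_bregman[OF z(2)[OF \<omega>] p, of a "G \<omega>"] by (simp add: z'(1)[OF \<omega>])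
    moreover have "0 \<le> a\<^sup>2 / (2 * \<sigma>) * (norm (G \<omega>))\<^sup>2"
      using sigma_pos by simp
    ultimately show "indicator A \<omega> * (bregman r p (z' \<omega>) - bregman r p (z \<omega>)) - a * (G \<omega> \<bullet> W \<omega>)
        \<le> a\<^sup>2 / (2 * \<sigma>) * (norm (G \<omega>))\<^sup>2"
      by (simp add: W_def indicator_def)
  qed (use int_diff inner moment in simp_all)
  also have "\<dots> \<le> a\<^sup>2 / (2 * \<sigma>) * K"
    using moment(2) sigma_pos by (simp add: mult_left_mono del: times_divide_eq_left)
  finally show "(\<integral>\<omega>. indicator A \<omega> * \<Delta> \<omega> \<partial>M) \<le> a\<^sup>2 / (2 * \<sigma>) * K" .
qed

section \<open>Regularity of the payoff\<close>

lemma exists_norm_gt: "\<exists>g :: 'a::euclidean_space. B < norm g"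
proof -
  obtain g :: 'a where "norm g = \<bar>B\<bar> + 1"
    using vector_choose_size[of "\<bar>B\<bar> + 1"] by auto
  then show ?thesis
    by (intro exI[of _ g]) linarith
qed

text \<open>At an infinite value the subgradient inequality does not depend on the vector, so the
  subdifferential is empty or the whole space, hence empty or unbounded.\<close>

lemma finite_if_bounded_subdifferential:
  fixes f :: "'a::euclidean_space \<Rightarrow> ereal"
  assumes ne: "subdifferential f u \<noteq> {}" and bdd: "\<And>g. g \<in> subdifferential f u \<Longrightarrow> norm g \<le> B"
  shows "f u = ereal (real_of_ereal (f u))"
proof (rule ccontr)
  assume "\<not> ?thesis"
  then have inf: "f u = \<infinity> \<or> f u = -\<infinity>"
    by (cases "f u") auto
  have "g \<in> subdifferential f u" for g
    using inf ne by (auto simp: subdifferential_def)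
  then show False
    using exists_norm_gt[of B, where 'a = 'a] bdd by (metis not_le)
qed

lemma subgradient_inequality:
  assumes "g \<in> subdifferential f u" "f u = ereal (real_of_ereal (f u))" "f w = ereal (real_of_ereal (f w))"
  shows "g \<bullet> (w - u) \<le> real_of_ereal (f w) - real_of_ereal (f u)"
proof -
  have "f u + ereal (g \<bullet> (w - u)) \<le> f w"
    using assms(1) by (simp add: subdifferential_def)
  then have "ereal (real_of_ereal (f u) + g \<bullet> (w - u)) \<le> ereal (real_of_ereal (f w))"
    by (metis assms(2,3) plus_ereal.simps(1))
  then show ?thesis by simp
qed

lemma supergradient_inequality:
  assumes "g \<in> superdifferential f u" "f u = ereal (real_of_ereal (f u))" "f w = ereal (real_of_ereal (f w))"
  shows "real_of_ereal (f w) - real_of_ereal (f u) \<le> g \<bullet> (w - u)"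
proof -
  have "f w \<le> f u + ereal (g \<bullet> (w - u))"
    using assms(1) by (simp add: superdifferential_def)
  then have "ereal (real_of_ereal (f w)) \<le> ereal (real_of_ereal (f u) + g \<bullet> (w - u))"
    by (metis assms(2,3) plus_ereal.simps(1))
  then show ?thesis by simp
qed

text \<open>The minorants at the two endpoints give the two one-sided estimates.\<close>

lemma lipschitz_if_bounded_linear_minorants:
  fixes f :: "'a::real_inner \<Rightarrow> real"
  assumes "\<And>u. u \<in> X \<Longrightarrow> \<exists>g. norm g \<le> B \<and> (\<forall>w\<in>X. g \<bullet> (w - u) \<le> f w - f u)" and "0 \<le> B"
  shows "B-lipschitz_on X f"
proof (rule lipschitz_onI)
  have *: "f u - f w \<le> B * dist u w" if uw: "u \<in> X" "w \<in> X" for u w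
  proof -
    obtain g where g: "norm g \<le> B" "g \<bullet> (w - u) \<le> f w - f u"
      using assms(1)[OF uw(1)] uw(2) by blast
    have "- (g \<bullet> (w - u)) \<le> norm g * norm (w - u)"
      using norm_cauchy_schwarz[of "- g" "w - u"] by simp
    also have "\<dots> \<le> B * norm (w - u)"
      by (intro mult_right_mono g) simp
    finally show ?thesis
      using g(2) by (simp add: dist_norm norm_minus_commute)
  qed
  show "dist (f u) (f w) \<le> B * dist u w" if "u \<in> X" "w \<in> X" for u w
    using *[of u w] *[of w u] that by (auto simp: dist_real_def abs_le_iff dist_commute)
qed (rule assms(2))

lemma continuous_on_if_separately_lipschitz:
  fixes f :: "'a::metric_space \<Rightarrow> 'b::metric_space \<Rightarrow> 'c::metric_space"
  assumes left: "\<And>v. v \<in> Y \<Longrightarrow> B-lipschitz_on X (\<lambda>u. f u v)"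
    and right: "\<And>u. u \<in> X \<Longrightarrow> B-lipschitz_on Y (f u)" and B: "0 \<le> B"
  shows "continuous_on (X \<times> Y) (\<lambda>w. f (fst w) (snd w))"
proof -
  have "(B + B)-lipschitz_on (X \<times> Y) (\<lambda>w. f (fst w) (snd w))"
  proof (rule lipschitz_onI)
    fix w w' assume w: "w \<in> X \<times> Y" "w' \<in> X \<times> Y"
    have "dist (f (fst w) (snd w)) (f (fst w') (snd w'))
        \<le> dist (f (fst w) (snd w)) (f (fst w') (snd w)) + dist (f (fst w') (snd w)) (f (fst w') (snd w'))"
      by (rule dist_triangle)
    also have "\<dots> \<le> B * dist (fst w) (fst w') + B * dist (snd w) (snd w')"
      using w by (intro add_mono lipschitz_onD[OF left] lipschitz_onD[OF right]) auto
    also have "\<dots> \<le> B * dist w w' + B * dist w w'"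
      by (intro add_mono mult_left_mono dist_fst_le dist_snd_le B)
    finally show "dist (f (fst w) (snd w)) (f (fst w') (snd w')) \<le> (B + B) * dist w w'"
      by (simp add: distrib_right)
  qed (use B in simp)
  then show ?thesis
    by (rule lipschitz_on_continuous_on)
qed

section \<open>The filtration of the iterates\<close>

lemma
  assumes "\<And>n. x n \<in> borel_measurable M" "\<And>n. y n \<in> borel_measurable M"
  shows subalgebra_history: "subalgebra M (history M x y n)"
    and sets_history_mono: "m \<le> n \<Longrightarrow> sets (history M x y m) \<subseteq> sets (history M x y n)"
    and history_measurable: "x n \<in> borel_measurable (history M x y n)"
      "y n \<in> borel_measurable (history M x y n)"
proof -
  let ?gen = "\<lambda>n. {x i -` A \<inter> space M | i A. i \<le> n \<and> A \<in> sets borel} \<union>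
      {y i -` A \<inter> space M | i A. i \<le> n \<and> A \<in> sets borel}"
  have sets: "sets (history M x y n) = sigma_sets (space M) (?gen n)" for n
    unfolding history_def by (rule sets_measure_of) auto
  have space: "space (history M x y n) = space M" for n
    unfolding history_def by (rule space_measure_of) auto
  have "?gen n \<subseteq> sets M" for n
    using assms by (auto intro: measurable_sets)
  then show "subalgebra M (history M x y n)"
    unfolding subalgebra_def sets space by (simp add: sets.sigma_sets_subset)
  show "sets (history M x y m) \<subseteq> sets (history M x y n)" if "m \<le> n"
    unfolding sets by (rule sigma_sets_mono') (use that in \<open>blast intro: order_trans\<close>)
  show "x n \<in> borel_measurable (history M x y n)" "y n \<in> borel_measurable (history M x y n)"
    by (rule measurableI; force simp: sets space intro!: sigma_sets.Basic)+
qed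

section \<open>Convergence to the saddle points\<close>

theorem theorem4:
  fixes X :: "(real ^ 'n) set" and Y :: "(real ^ 'm) set"
    and L :: "real ^ 'n \<Rightarrow> real ^ 'm \<Rightarrow> ereal"
    and Rx :: "real ^ 'n \<Rightarrow> ereal" and Ry :: "real ^ 'm \<Rightarrow> ereal"
    and \<sigma> \<rho> :: real
    and M :: "'w measure"
    and x Gx :: "nat \<Rightarrow> 'w \<Rightarrow> real ^ 'n" and \<gamma> Gy :: "nat \<Rightarrow> 'w \<Rightarrow> real ^ 'm"
    and \<alpha> :: "nat \<Rightarrow> real"
  defines "S \<equiv> saddle_points X Y L"
    and "F \<equiv> history M x \<gamma>"
  assumes X: "X \<noteq> {}" "convex X" "compact X"
    and Y: "Y \<noteq> {}" "convex Y" "compact Y"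
    and L_convex: "\<And>v. ereal_convex (\<lambda>u. L u v)"
    and L_concave: "\<And>u. ereal_concave (\<lambda>v. L u v)"
    and A1_S: "S \<noteq> {}" "compact S"
    and A1_separation: "\<And>u v. (u, v) \<in> (X \<times> Y) - S \<Longrightarrow>
          \<exists>(us, vs)\<in>S. L us v < L us vs \<or> L us vs < L u vs"
    and A2_usc: "\<And>u. u \<in> X \<Longrightarrow> upper_semicont (\<lambda>v. L u v)"
    and A2_lsc: "\<And>v. v \<in> Y \<Longrightarrow> lower_semicont (\<lambda>u. L u v)"
    and A3_nonempty: "\<And>u v. u \<in> X \<Longrightarrow> v \<in> Y \<Longrightarrow>
          subdifferential (\<lambda>u'. L u' v) u \<times> superdifferential (\<lambda>v'. L u v') v \<noteq> {}"
    and A3_bounded: "\<exists>G>0. \<forall>u\<in>X. \<forall>v\<in>Y.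
          (\<forall>g\<in>subdifferential (\<lambda>u'. L u' v) u. norm g \<le> G) \<and>
          (\<forall>g\<in>superdifferential (\<lambda>v'. L u v') v. norm g \<le> G)"
    and sigma_pos: "\<sigma> > 0"
    and Rx: "mirror_regularizer \<sigma> \<rho> X Rx"
    and Ry: "mirror_regularizer \<sigma> \<rho> Y Ry"
    and M: "prob_space M"
    and init_measurable: "x 0 \<in> borel_measurable M" "\<gamma> 0 \<in> borel_measurable M"
    and init_mem: "\<And>\<omega>. \<omega> \<in> space M \<Longrightarrow> x 0 \<omega> \<in> X \<and> \<gamma> 0 \<omega> \<in> Y"
    and G_measurable: "\<And>n. Gx n \<in> borel_measurable M" "\<And>n. Gy n \<in> borel_measurable M"
    and step_pos: "\<And>n. \<alpha> n > 0"
    and x_step: "\<And>n \<omega>. \<omega> \<in> space M \<Longrightarrow>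
          x (Suc n) \<omega> = mirror_map X Rx (ereal_grad Rx (x n \<omega>) - \<alpha> n *\<^sub>R Gx n \<omega>)"
    and \<gamma>_step: "\<And>n \<omega>. \<omega> \<in> space M \<Longrightarrow>
          \<gamma> (Suc n) \<omega> = mirror_map Y Ry (ereal_grad Ry (\<gamma> n \<omega>) + \<alpha> n *\<^sub>R Gy n \<omega>)"
    and A4_x: "\<And>n. AE \<omega> in M.
          vec_cond_exp M (F n) (Gx n) \<omega> \<in> subdifferential (\<lambda>u. L u (\<gamma> n \<omega>)) (x n \<omega>)"
    and A4_\<gamma>: "\<And>n. AE \<omega> in M.
          vec_cond_exp M (F n) (Gy n) \<omega> \<in> superdifferential (\<lambda>v. L (x n \<omega>) v) (\<gamma> n \<omega>)"
    and A5: "\<exists>K>0. \<forall>n. AE \<omega> in M.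
          nn_cond_exp M (F n) (\<lambda>\<omega>'. ennreal ((norm (Gx n \<omega>'))\<^sup>2)) \<omega> \<le> ennreal K \<and>
          nn_cond_exp M (F n) (\<lambda>\<omega>'. ennreal ((norm (Gy n \<omega>'))\<^sup>2)) \<omega> \<le> ennreal K"
    and A6: "filterlim (\<lambda>N. \<Sum>n<N. \<alpha> n) at_top sequentially" "summable (\<lambda>n. (\<alpha> n)\<^sup>2)"
  shows "AE \<omega> in M. (\<lambda>n. infdist (x n \<omega>, \<gamma> n \<omega>) S) \<longlonglongrightarrow> 0"
proof -
  define rx where "rx = (\<lambda>u. real_of_ereal (Rx u))"
  define ry where "ry = (\<lambda>v. real_of_ereal (Ry v))"
  define l where "l u v = real_of_ereal (L u v)" for u v
  interpret gx: mirror_geometry X Rx rx \<sigma>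
    unfolding rx_def using mirror_regularizer_imp_geometry[OF X sigma_pos Rx] .
  interpret gy: mirror_geometry Y Ry ry \<sigma>
    unfolding ry_def using mirror_regularizer_imp_geometry[OF Y sigma_pos Ry] .
  interpret prob_space M by (rule M)
  obtain B where B: "0 < B"
    "\<And>u v g. u \<in> X \<Longrightarrow> v \<in> Y \<Longrightarrow> g \<in> subdifferential (\<lambda>u'. L u' v) u \<Longrightarrow> norm g \<le> B"
    "\<And>u v g. u \<in> X \<Longrightarrow> v \<in> Y \<Longrightarrow> g \<in> superdifferential (\<lambda>v'. L u v') v \<Longrightarrow> norm g \<le> B"
    using A3_bounded by blast
  obtain K where K: "0 < K"
    "\<And>n. AE \<omega> in M. nn_cond_exp M (F n) (\<lambda>\<omega>'. ennreal ((norm (Gx n \<omega>'))\<^sup>2)) \<omega> \<le> ennreal K"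
    "\<And>n. AE \<omega> in M. nn_cond_exp M (F n) (\<lambda>\<omega>'. ennreal ((norm (Gy n \<omega>'))\<^sup>2)) \<omega> \<le> ennreal K"
    using A5 by (auto simp: AE_conj_iff)

  \<comment> \<open>The bound on the subgradients makes the payoff finite on \<open>X \<times> Y\<close>, so all estimates can be made
    with the real-valued \<open>l\<close>.\<close>
  have L_finite: "L u v = ereal (real_of_ereal (L u v))" if "u \<in> X" "v \<in> Y" for u v
    by (rule finite_if_bounded_subdifferential[where f = "\<lambda>u. L u v" and B = B])
       (use A3_nonempty[OF that] B(2)[OF that] in auto)
  then have L_eq: "L u v = ereal (l u v)" if "u \<in> X" "v \<in> Y" for u v
    using that unfolding l_def by blast
  have sub_l: "g \<bullet> (u' - u) \<le> l u' v - l u v"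
    if "g \<in> subdifferential (\<lambda>u'. L u' v) u" "u \<in> X" "u' \<in> X" "v \<in> Y" for g u u' v
    unfolding l_def
    by (rule subgradient_inequality[where f = "\<lambda>u'. L u' v", OF that(1)]) (intro L_finite that)+
  have super_l: "l u v' - l u v \<le> g \<bullet> (v' - v)"
    if "g \<in> superdifferential (\<lambda>v'. L u v') v" "u \<in> X" "v \<in> Y" "v' \<in> Y" for g u v v'
    unfolding l_def
    by (rule supergradient_inequality[where f = "\<lambda>v'. L u v'", OF that(1)]) (intro L_finite that)+
  have l_cont: "continuous_on (X \<times> Y) (\<lambda>w. l (fst w) (snd w))"
  proof (rule continuous_on_if_separately_lipschitz)
    show "B-lipschitz_on X (\<lambda>u. l u v)" if v: "v \<in> Y" for v
    proof (rule lipschitz_if_bounded_linear_minorants)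
      fix u assume u: "u \<in> X"
      then obtain g where "g \<in> subdifferential (\<lambda>u'. L u' v) u"
        using A3_nonempty[OF u v] by blast
      then show "\<exists>g. norm g \<le> B \<and> (\<forall>w\<in>X. g \<bullet> (w - u) \<le> l w v - l u v)"
        using B(2) sub_l u v by blast
    qed (use B in simp)
    show "B-lipschitz_on Y (l u)" if u: "u \<in> X" for u
    proof -
      have "B-lipschitz_on Y (\<lambda>v. - l u v)"
      proof (rule lipschitz_if_bounded_linear_minorants)
        fix v assume v: "v \<in> Y"
        then obtain g where g: "g \<in> superdifferential (\<lambda>v'. L u v') v"
          using A3_nonempty[OF u v] by blast
        show "\<exists>g. norm g \<le> B \<and> (\<forall>w\<in>Y. g \<bullet> (w - v) \<le> - l u w - - l u v)"
        proof (intro exI[of _ "- g"] conjI ballI)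
          show "norm (- g) \<le> B"
            using B(3)[OF u v g] by simp
          show "- g \<bullet> (w - v) \<le> - l u w - - l u v" if "w \<in> Y" for w
            using super_l[OF g u v that] by simp
        qed
      qed (use B in simp)
      then show ?thesis
        by (simp add: lipschitz_on_def dist_real_def abs_minus_commute)
    qed
  qed (use B in simp)

  define D where "D p q = bregman rx (fst p) (fst q) + bregman ry (snd p) (snd q)" for p q
  define gap where "gap s w = l (fst w) (snd s) - l (fst s) (snd w)" for s w
  have D_cont: "continuous_on ((X \<times> Y) \<times> (X \<times> Y)) (\<lambda>w. D (fst w) (snd w))"
  proof -
    have "continuous_on ((X \<times> Y) \<times> (X \<times> Y))
        (\<lambda>w. bregman rx (fst (fst (fst w), fst (snd w))) (snd (fst (fst w), fst (snd w))))"
      by (rule continuous_on_compose2[OF gx.continuous_bregman]) (auto intro!: continuous_intros)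
    moreover have "continuous_on ((X \<times> Y) \<times> (X \<times> Y))
        (\<lambda>w. bregman ry (fst (snd (fst w), snd (snd w))) (snd (snd (fst w), snd (snd w))))"
      by (rule continuous_on_compose2[OF gy.continuous_bregman]) (auto intro!: continuous_intros)
    ultimately show ?thesis
      unfolding D_def by (auto intro: continuous_on_add)
  qed
  have D_section: "continuous_on (X \<times> Y) (D p)" if "p \<in> X \<times> Y" for p
  proof -
    have "continuous_on (X \<times> Y) (\<lambda>q. D (fst (p, q)) (snd (p, q)))"
      by (rule continuous_on_compose2[OF D_cont
            continuous_on_Pair[OF continuous_on_const continuous_on_id]]) (use that in auto)
    then show ?thesis by simp
  qed
  have D_lower: "\<sigma> / 2 * (dist p q)\<^sup>2 \<le> D p q" if "p \<in> X \<times> Y" "q \<in> X \<times> Y" for p q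
  proof -
    have "(dist p q)\<^sup>2 = (norm (fst p - fst q))\<^sup>2 + (norm (snd p - snd q))\<^sup>2"
      by (simp add: dist_prod_def dist_norm)
    then show ?thesis
      using gx.bregman_lower_bound[of "fst p" "fst q"] gy.bregman_lower_bound[of "snd p" "snd q"] that
      by (auto simp: D_def distrib_left)
  qed
  obtain Bx By where "\<And>p q. p \<in> X \<Longrightarrow> q \<in> X \<Longrightarrow> bregman rx p q \<le> Bx"
      "\<And>p q. p \<in> Y \<Longrightarrow> q \<in> Y \<Longrightarrow> bregman ry p q \<le> By"
    using gx.bregman_bounded gy.bregman_bounded by blast
  then have D_bounds: "0 \<le> D p q \<and> D p q \<le> Bx + By" if "p \<in> X \<times> Y" "q \<in> X \<times> Y" for p q
    using that by (auto simp: D_def intro!: add_mono add_nonneg_nonneg gx.bregman_nonneg gy.bregman_nonneg)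

  have gap_cont: "continuous_on ((X \<times> Y) \<times> (X \<times> Y)) (\<lambda>w. gap (fst w) (snd w))"
  proof -
    have "continuous_on ((X \<times> Y) \<times> (X \<times> Y))
        (\<lambda>w. l (fst (fst (snd w), snd (fst w))) (snd (fst (snd w), snd (fst w))))"
      by (rule continuous_on_compose2[OF l_cont]) (auto intro!: continuous_intros)
    moreover have "continuous_on ((X \<times> Y) \<times> (X \<times> Y))
        (\<lambda>w. l (fst (fst (fst w), snd (snd w))) (snd (fst (fst w), snd (snd w))))"
      by (rule continuous_on_compose2[OF l_cont]) (auto intro!: continuous_intros)
    ultimately show ?thesis
      unfolding gap_def by (auto intro: continuous_on_diff)
  qed
  have gap_section: "continuous_on (X \<times> Y) (gap s)" if "s \<in> X \<times> Y" for s
  proof -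
    have "continuous_on (X \<times> Y) (\<lambda>q. gap (fst (s, q)) (snd (s, q)))"
      by (rule continuous_on_compose2[OF gap_cont
            continuous_on_Pair[OF continuous_on_const continuous_on_id]]) (use that in auto)
    then show ?thesis by simp
  qed
  have S_sub: "S \<subseteq> X \<times> Y"
    by (auto simp: S_def saddle_points_def)
  have saddle: "l us v \<le> l us vs" "l us vs \<le> l u vs"
    if "(us, vs) \<in> S" "u \<in> X" "v \<in> Y" for us vs u v
    using that L_eq by (auto simp: S_def saddle_points_def)
  have gap_nonneg: "0 \<le> gap s w" if "s \<in> S" "w \<in> X \<times> Y" for s w
    using saddle[of "fst s" "snd s" "fst w" "snd w"] that by (auto simp: gap_def)
  have gap_zero: "w \<in> S" if w: "w \<in> X \<times> Y" and zero: "\<And>s. s \<in> S \<Longrightarrow> gap s w = 0" for w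
  proof (rule ccontr)
    assume "w \<notin> S"
    then obtain us vs where s: "(us, vs) \<in> S"
        "L us (snd w) < L us vs \<or> L us vs < L (fst w) vs"
      using A1_separation[of "fst w" "snd w"] w by (auto split: prod.splits)
    then have "l us (snd w) < l us vs \<or> l us vs < l (fst w) vs"
      using w S_sub L_eq by (auto simp: mem_Times_iff)
    then have "0 < gap (us, vs) w"
      using saddle[OF s(1), of "fst w" "snd w"] w by (auto simp: gap_def)
    then show False
      using zero[OF s(1)] by simp
  qed

  have mem: "x n \<omega> \<in> X" "\<gamma> n \<omega> \<in> Y" if "\<omega> \<in> space M" for n \<omega>
    using init_mem[OF that] x_step[OF that] \<gamma>_step[OF that] gx.mirror_map_mem gy.mirror_map_mem
    by (cases n; simp)+
  have x_meas: "x n \<in> borel_measurable M" for n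
  proof (induction n)
    case (Suc n)
    have "(\<lambda>\<omega>. mirror_map X Rx (grad rx (x n \<omega>) - \<alpha> n *\<^sub>R Gx n \<omega>)) \<in> borel_measurable M"
      by (intro borel_measurable_continuous_on[OF gx.continuous_mirror_map] borel_measurable_diff
          borel_measurable_scaleR borel_measurable_const G_measurable
          borel_measurable_continuous_on_compose[OF Suc mem(1) gx.continuous_grad])
    then show ?case
      by (subst measurable_cong[OF x_step]) (simp_all add: gx.ereal_grad_eq)
  qed (rule init_measurable)
  have \<gamma>_meas: "\<gamma> n \<in> borel_measurable M" for n
  proof (induction n)
    case (Suc n)
    have "(\<lambda>\<omega>. mirror_map Y Ry (grad ry (\<gamma> n \<omega>) + \<alpha> n *\<^sub>R Gy n \<omega>)) \<in> borel_measurable M"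
      by (intro borel_measurable_continuous_on[OF gy.continuous_mirror_map] borel_measurable_add
          borel_measurable_scaleR borel_measurable_const G_measurable
          borel_measurable_continuous_on_compose[OF Suc mem(2) gy.continuous_grad])
    then show ?case
      by (subst measurable_cong[OF \<gamma>_step]) (simp_all add: gy.ereal_grad_eq)
  qed (rule init_measurable)
  have F_sub: "subalgebra M (F n)" for n
    unfolding F_def by (rule subalgebra_history[OF x_meas \<gamma>_meas])
  have F_mono: "sets (F m) \<subseteq> sets (F n)" if "m \<le> n" for m n
    unfolding F_def by (rule sets_history_mono[OF x_meas \<gamma>_meas that])
  have x_F: "x n \<in> borel_measurable (F n)" and \<gamma>_F: "\<gamma> n \<in> borel_measurable (F n)" for n
    unfolding F_def by (rule history_measurable[OF x_meas \<gamma>_meas])+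
  have space_F: "space (F n) = space M" for n
    using F_sub by (simp add: subalgebra_def)
  define z where "z n \<omega> = (x n \<omega>, \<gamma> n \<omega>)" for n \<omega>
  have z_mem: "z n \<omega> \<in> X \<times> Y" if "\<omega> \<in> space M" for n \<omega>
    using mem[OF that] by (simp add: z_def)
  have z_F: "z n \<in> borel_measurable (F n)" for n
    unfolding z_def by (intro borel_measurable_Pair x_F \<gamma>_F)

  have descent: "AE \<omega> in M. convergent (\<lambda>n. D s (z n \<omega>)) \<and> summable (\<lambda>n. \<alpha> n * gap s (z n \<omega>))"
    if s: "s \<in> S" for s
  proof (rule robbins_siegmund_bounded[where F = F and B = "Bx + By"
        and c = "\<lambda>n. (\<alpha> n)\<^sup>2 / (2 * \<sigma>) * K + (- \<alpha> n)\<^sup>2 / (2 * \<sigma>) * K"])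
    have s_mem: "s \<in> X \<times> Y" "fst s \<in> X" "snd s \<in> Y"
      using s S_sub by auto
    show D_F: "(\<lambda>\<omega>. D s (z n \<omega>)) \<in> borel_measurable (F n)" for n
      by (rule borel_measurable_continuous_on_compose[OF z_F _ D_section[OF s_mem(1)]])
         (simp only: space_F z_mem)
    have gap_F: "(\<lambda>\<omega>. gap s (z n \<omega>)) \<in> borel_measurable (F n)" for n
      by (rule borel_measurable_continuous_on_compose[OF z_F _ gap_section[OF s_mem(1)]])
         (simp only: space_F z_mem)
    have int_D: "integrable M (\<lambda>\<omega>. D s (z n \<omega>))" for n
      using measurable_from_subalg[OF F_sub D_F] D_bounds[OF s_mem(1) z_mem]
      by (intro integrable_const_bound[of _ "Bx + By"] AE_I2) auto
    have "bounded (gap s ` (X \<times> Y))"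
      by (intro compact_imp_bounded compact_continuous_image gap_section s_mem compact_Times X Y)
    then obtain C where C: "\<And>w. w \<in> X \<times> Y \<Longrightarrow> norm (gap s w) \<le> C"
      unfolding bounded_iff by blast
    have int_gap: "integrable M (\<lambda>\<omega>. gap s (z n \<omega>))" for n
      using measurable_from_subalg[OF F_sub gap_F] C[OF z_mem]
      by (intro integrable_const_bound[of _ C] AE_I2) auto
    then show "integrable M (\<lambda>\<omega>. \<alpha> n * gap s (z n \<omega>))" for n
      by simp
    show "0 \<le> D s (z n \<omega>) \<and> D s (z n \<omega>) \<le> Bx + By" if "\<omega> \<in> space M" for n \<omega>
      by (rule D_bounds[OF s_mem(1) z_mem[OF that]])
    show "0 \<le> \<alpha> n * gap s (z n \<omega>)" if "\<omega> \<in> space M" for n \<omega>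
      using gap_nonneg[OF s z_mem[OF that]] step_pos[of n] by (simp add: less_imp_le)
    show "summable (\<lambda>n. (\<alpha> n)\<^sup>2 / (2 * \<sigma>) * K + (- \<alpha> n)\<^sup>2 / (2 * \<sigma>) * K)"
      unfolding power2_minus by (intro summable_add summable_mult2 summable_divide A6)
    show "0 \<le> (\<alpha> n)\<^sup>2 / (2 * \<sigma>) * K + (- \<alpha> n)\<^sup>2 / (2 * \<sigma>) * K" for n
      using sigma_pos K(1) by simp
    show "(\<integral>\<omega>. indicator A \<omega> * (D s (z (Suc n) \<omega>) - D s (z n \<omega>) + \<alpha> n * gap s (z n \<omega>)) \<partial>M)
        \<le> (\<alpha> n)\<^sup>2 / (2 * \<sigma>) * K + (- \<alpha> n)\<^sup>2 / (2 * \<sigma>) * K" if A: "A \<in> sets (F n)" for n A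
    proof -
      define \<Delta>x where "\<Delta>x \<omega> = bregman rx (fst s) (x (Suc n) \<omega>) - bregman rx (fst s) (x n \<omega>)
        - \<alpha> n * (vec_cond_exp M (F n) (Gx n) \<omega> \<bullet> (fst s - x n \<omega>))" for \<omega>
      define \<Delta>y where "\<Delta>y \<omega> = bregman ry (snd s) (\<gamma> (Suc n) \<omega>) - bregman ry (snd s) (\<gamma> n \<omega>)
        - (- \<alpha> n) * (vec_cond_exp M (F n) (Gy n) \<omega> \<bullet> (snd s - \<gamma> n \<omega>))" for \<omega>
      \<comment> \<open>The ascent step of \<open>\<gamma>\<close> is a mirror descent step with step size \<open>- \<alpha> n\<close>.\<close>
      have x_upd: "x (Suc n) \<omega> = mirror_map X Rx (grad rx (x n \<omega>) - \<alpha> n *\<^sub>R Gx n \<omega>)"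
        and \<gamma>_upd: "\<gamma> (Suc n) \<omega> = mirror_map Y Ry (grad ry (\<gamma> n \<omega>) - (- \<alpha> n) *\<^sub>R Gy n \<omega>)"
        if "\<omega> \<in> space M" for \<omega>
        by (simp_all add: x_step[OF that] \<gamma>_step[OF that] gx.ereal_grad_eq gy.ereal_grad_eq)
      note step_x = expected_mirror_step[OF gx.mirror_geometry_axioms M F_sub x_F mem(1) x_upd x_meas
          G_measurable(1) less_imp_le[OF K(1)] K(2) s_mem(2) A, folded \<Delta>x_def]
      note step_y = expected_mirror_step[OF gy.mirror_geometry_axioms M F_sub \<gamma>_F mem(2) \<gamma>_upd \<gamma>_meas
          G_measurable(2) less_imp_le[OF K(1)] K(3) s_mem(3) A, folded \<Delta>y_def]
      have A_M: "A \<in> sets M"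
        using A F_sub by (auto simp: subalgebra_def)
      have "(\<integral>\<omega>. indicator A \<omega> * (D s (z (Suc n) \<omega>) - D s (z n \<omega>) + \<alpha> n * gap s (z n \<omega>)) \<partial>M)
          \<le> (\<integral>\<omega>. indicator A \<omega> * \<Delta>x \<omega> + indicator A \<omega> * \<Delta>y \<omega> \<partial>M)"
      proof (rule integral_mono_AE)
        show "integrable M (\<lambda>\<omega>. indicator A \<omega> * (D s (z (Suc n) \<omega>) - D s (z n \<omega>) + \<alpha> n * gap s (z n \<omega>)))"
          using integrable_mult_indicator[OF A_M, of "\<lambda>\<omega>. D s (z (Suc n) \<omega>) - D s (z n \<omega>) + \<alpha> n * gap s (z n \<omega>)"]
            int_D int_gap by simp
        show "integrable M (\<lambda>\<omega>. indicator A \<omega> * \<Delta>x \<omega> + indicator A \<omega> * \<Delta>y \<omega>)"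
          using step_x(1) step_y(1) by (rule Bochner_Integration.integrable_add)
        show "AE \<omega> in M. indicator A \<omega> * (D s (z (Suc n) \<omega>) - D s (z n \<omega>) + \<alpha> n * gap s (z n \<omega>))
            \<le> indicator A \<omega> * \<Delta>x \<omega> + indicator A \<omega> * \<Delta>y \<omega>"
          using A4_x[of n] A4_\<gamma>[of n] AE_space
        proof eventually_elim
          case (elim \<omega>)
          have "gap s (z n \<omega>) \<le> vec_cond_exp M (F n) (Gy n) \<omega> \<bullet> (snd s - \<gamma> n \<omega>)
              - vec_cond_exp M (F n) (Gx n) \<omega> \<bullet> (fst s - x n \<omega>)"
            using sub_l[OF elim(1) mem(1)[OF elim(3)] s_mem(2) mem(2)[OF elim(3)]]
              super_l[OF elim(2) mem[OF elim(3)] s_mem(3)]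
            by (simp add: gap_def z_def)
          from mult_left_mono[OF this less_imp_le[OF step_pos[of n]]]
          have "D s (z (Suc n) \<omega>) - D s (z n \<omega>) + \<alpha> n * gap s (z n \<omega>) \<le> \<Delta>x \<omega> + \<Delta>y \<omega>"
            by (simp add: \<Delta>x_def \<Delta>y_def D_def z_def right_diff_distrib)
          then show ?case
            by (simp add: indicator_def)
        qed
      qed
      also have "\<dots> = (\<integral>\<omega>. indicator A \<omega> * \<Delta>x \<omega> \<partial>M) + (\<integral>\<omega>. indicator A \<omega> * \<Delta>y \<omega> \<partial>M)"
        using step_x(1) step_y(1) by (rule Bochner_Integration.integral_add)
      also have "\<dots> \<le> (\<alpha> n)\<^sup>2 / (2 * \<sigma>) * K + (- \<alpha> n)\<^sup>2 / (2 * \<sigma>) * K"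
        using step_x(2) step_y(2) by (rule add_mono)
      finally show ?thesis .
    qed
  qed (use M F_sub F_mono in simp_all)

  obtain T where T: "countable T" "T \<subseteq> S" "S \<subseteq> closure T"
    using separable[of S] by blast
  have T_ne: "T \<noteq> {}"
    using T(3) A1_S(1) by auto
  have "AE \<omega> in M. \<forall>s\<in>T. convergent (\<lambda>n. D s (z n \<omega>)) \<and> summable (\<lambda>n. \<alpha> n * gap s (z n \<omega>))"
    using descent T(2) by (subst AE_ball_countable[OF T(1)]) blast
  then show ?thesis
    using AE_space
  proof eventually_elim
    case (elim \<omega>)
    have "\<exists>q\<in>S. (\<lambda>n. z n \<omega>) \<longlonglongrightarrow> q"
    proof (rule quasi_fejer_convergence[OF _ _ S_sub T(1) T_ne T(2,3) D_cont _ _ D_lower gap_cont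
          gap_nonneg gap_zero _ A6(1)])
      show "compact (X \<times> Y)"
        by (intro compact_Times X Y)
      show "D p p = 0" for p
        by (simp add: D_def bregman_def)
    qed (use elim sigma_pos step_pos z_mem in \<open>auto simp: less_imp_le\<close>)
    then obtain q where q: "q \<in> S" "(\<lambda>n. z n \<omega>) \<longlonglongrightarrow> q"
      by blast
    show ?case
    proof (rule tendsto_sandwich[of "\<lambda>_. 0" _ _ "\<lambda>n. dist (z n \<omega>) q"])
      show "(\<lambda>n. dist (z n \<omega>) q) \<longlonglongrightarrow> 0"
        using q(2) by (subst (asm) tendsto_dist_iff)
      show "\<forall>\<^sub>F n in sequentially. infdist (x n \<omega>, \<gamma> n \<omega>) S \<le> dist (z n \<omega>) q"
        by (simp add: z_def infdist_le[OF q(1)])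
    qed (simp_all add: infdist_nonneg)
  qed
qed

end
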